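(* Let $f:\omega\to\omega$ be not densely computable. Then $\mu(\{X\subseteq\omega : f \text{ is densely computable relative to } X\})=0$; indeed, no element of this class is weakly $4$-random relative to $f$. Consequently, for every set $A\subseteq\omega$ that is not densely computable, the classes $\{X : A\le_{\mathrm{ud}} X\}$ and $\{X: A\le_{\mathrm{nd}} X\}$ have measure $0$.
   Context: $\mu$ is Lebesgue (fair-coin) measure on $2^\omega$, identifying sets with their characteristic sequences. For $A\subseteq\omega$, $\rho_n(A)=|A\cap\{0,\dots,n-1\}|/n$ and $\rho(A)=\lim_n\rho_n(A)$ when it exists. A dense description of $g:\omega\to\omega$ is a partial function $d$ with $\rho(\{n: d(n)=g(n)\})=1$. $g$ is densely computable (relative to $X$) if it has a partial computable (partial $X$-computable) dense description. A set $X$ is weakly $n$-random relative to $Z$ if $X$ lies in no $\Pi^{0,Z}_n$ class of measure $0$. An enumeration operator is a c.e. set $W$ of pairs $(F,k)$ with $F$ finite; $W^Y=\{k: \exists (F,k)\in W,\ F\subseteq Y\}$; a partial function $e$ is enumeration reducible to a partial function $d$ if $\mathrm{gra}(e)=W^{\mathrm{gra}(d)}$ for some enumeration operator $W$. $h\le_{\mathrm{nd}} g$ means every dense description $d$ of $g$ has a dense description $e$ of $h$ enumeration reducible to $d$; $h\le_{\mathrm{ud}} g$ means there is a single enumeration operator $W$ such that for every dense description $d$ of $g$, $W^{\mathrm{gra}(d)}$ is the graph of a dense description of $h$. Sets are identified with their characteristic functions. *)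

theory Defs
  imports "HOL-Probability.Probability" "HOL-Library.Nat_Bijection"
begin

text \<open>
  Partial recursive functions relative to an oracle \<^term>\<open>Z :: nat \<Rightarrow> nat\<close>. Codes carry no
  arity: each code computes a partial recursive function of every arity, and a basic function or
  recursion applied to an argument list that does not fit it is undefined.
\<close>

datatype recf =
    Zero
  | Succ
  | Proj nat
  | Query
  | Comp recf "recf list"
  | PrimRec recf recf
  | Mu recf

fun run :: "(nat \<Rightarrow> nat) \<Rightarrow> recf \<Rightarrow> nat list \<Rightarrow> nat option" where
  "run Z Zero xs = Some 0"
| "run Z Succ xs = (case xs of [x] \<Rightarrow> Some (Suc x) | _ \<Rightarrow> None)"
| "run Z (Proj i) xs = (if i < length xs then Some (xs ! i) else None)"
| "run Z Query xs = (case xs of [x] \<Rightarrow> Some (Z x) | _ \<Rightarrow> None)"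
| "run Z (Comp h gs) xs =
     (if \<forall>g\<in>set gs. run Z g xs \<noteq> None then run Z h (map (\<lambda>g. the (run Z g xs)) gs) else None)"
| "run Z (PrimRec h g) xs =
     (case xs of
        [] \<Rightarrow> None
      | n # ys \<Rightarrow>
          rec_nat (run Z h ys)
            (\<lambda>k r. case r of None \<Rightarrow> None | Some v \<Rightarrow> run Z g (k # v # ys)) n)"
| "run Z (Mu h) xs =
     (if \<exists>n. run Z h (n # xs) = Some 0 \<and> (\<forall>m<n. run Z h (m # xs) \<noteq> None)
      then Some (LEAST n. run Z h (n # xs) = Some 0) else None)"

fun oracle_free :: "recf \<Rightarrow> bool" where
  "oracle_free Zero = True"
| "oracle_free Succ = True"
| "oracle_free (Proj i) = True"
| "oracle_free Query = False"
| "oracle_free (Comp h gs) = (oracle_free h \<and> (\<forall>g\<in>set gs. oracle_free g))"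
| "oracle_free (PrimRec h g) = (oracle_free h \<and> oracle_free g)"
| "oracle_free (Mu h) = oracle_free h"

definition partial_computable_in :: "(nat \<Rightarrow> nat) \<Rightarrow> (nat \<Rightarrow> nat option) \<Rightarrow> bool" where
  "partial_computable_in Z \<phi> \<longleftrightarrow> (\<exists>c. \<forall>n. run Z c [n] = \<phi> n)"

text \<open>An oracle-free code never consults its oracle, so the choice of oracle below is immaterial.\<close>

definition partial_computable :: "(nat \<Rightarrow> nat option) \<Rightarrow> bool" where
  "partial_computable \<phi> \<longleftrightarrow> (\<exists>c. oracle_free c \<and> (\<forall>n. run (\<lambda>_. 0) c [n] = \<phi> n))"

definition ce_set :: "nat set \<Rightarrow> bool" where
  "ce_set S \<longleftrightarrow> (\<exists>\<phi>. partial_computable \<phi> \<and> S = dom \<phi>)"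

text \<open>Subsets of \<open>\<omega>\<close> are represented by their characteristic sequences \<^typ>\<open>nat \<Rightarrow> bool\<close>.\<close>

definition char_fun :: "(nat \<Rightarrow> bool) \<Rightarrow> nat \<Rightarrow> nat" where
  "char_fun X n = of_bool (X n)"

definition rho_upto :: "nat \<Rightarrow> nat set \<Rightarrow> real" where
  "rho_upto n A = real (card (A \<inter> {0..<n})) / real n"

definition has_density :: "nat set \<Rightarrow> real \<Rightarrow> bool" where
  "has_density A r \<longleftrightarrow> (\<lambda>n. rho_upto n A) \<longlonglongrightarrow> r"

definition dense_description :: "(nat \<Rightarrow> nat option) \<Rightarrow> (nat \<Rightarrow> nat) \<Rightarrow> bool" where
  "dense_description d g \<longleftrightarrow> has_density {n. d n = Some (g n)} 1"

definition densely_computable :: "(nat \<Rightarrow> nat) \<Rightarrow> bool" where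
  "densely_computable g \<longleftrightarrow> (\<exists>d. partial_computable d \<and> dense_description d g)"

definition densely_computable_in :: "(nat \<Rightarrow> bool) \<Rightarrow> (nat \<Rightarrow> nat) \<Rightarrow> bool" where
  "densely_computable_in X g \<longleftrightarrow>
     (\<exists>d. partial_computable_in (char_fun X) d \<and> dense_description d g)"

text \<open>
  Lebesgue measure on Cantor space is taken to be complete, since the classes defined through
  quantification over all dense descriptions need not be Borel.
\<close>

definition fair_coin_measure :: "(nat \<Rightarrow> bool) measure" where
  "fair_coin_measure =
     completion (PiM (UNIV :: nat set) (\<lambda>_. measure_pmf (bernoulli_pmf (1 / 2))))"

definition oracle_join :: "(nat \<Rightarrow> nat) \<Rightarrow> (nat \<Rightarrow> nat) \<Rightarrow> nat \<Rightarrow> nat" where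
  "oracle_join Y Z n = (if even n then Y (n div 2) else Z (n div 2))"

text \<open>
  \<open>pi_prefix n R\<close> and \<open>sigma_prefix n R\<close> prefix \<open>R(x\<^sub>1, \<dots>, x\<^sub>n)\<close> with \<open>n\<close> alternating number
  quantifiers, beginning with \<open>\<forall>\<close> and \<open>\<exists>\<close> respectively.
\<close>

fun pi_prefix :: "nat \<Rightarrow> (nat list \<Rightarrow> bool) \<Rightarrow> bool"
  and sigma_prefix :: "nat \<Rightarrow> (nat list \<Rightarrow> bool) \<Rightarrow> bool" where
  "pi_prefix 0 R = R []"
| "pi_prefix (Suc n) R = (\<forall>x. sigma_prefix n (\<lambda>xs. R (x # xs)))"
| "sigma_prefix 0 R = R []"
| "sigma_prefix (Suc n) R = (\<exists>x. pi_prefix n (\<lambda>xs. R (x # xs)))"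

text \<open>
  The matrix of a \<open>\<Pi>\<^sub>n\<close> class relative to \<open>Z\<close> is a relation \<open>R(x\<^sub>1, \<dots>, x\<^sub>n, X)\<close> decided by a single
  procedure, total for every \<open>X\<close>, with oracle the join of \<open>X\<close> and \<open>Z\<close>.
\<close>

definition pi_class :: "nat \<Rightarrow> (nat \<Rightarrow> nat) \<Rightarrow> (nat \<Rightarrow> bool) set \<Rightarrow> bool" where
  "pi_class n Z C \<longleftrightarrow>
     (\<exists>c. (\<forall>X xs. length xs = n \<longrightarrow> run (oracle_join (char_fun X) Z) c xs \<in> {Some 0, Some 1}) \<and>
          C = {X. pi_prefix n (\<lambda>xs. run (oracle_join (char_fun X) Z) c xs = Some 1)})"

definition weakly_random :: "nat \<Rightarrow> (nat \<Rightarrow> nat) \<Rightarrow> (nat \<Rightarrow> bool) \<Rightarrow> bool" where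
  "weakly_random n Z X \<longleftrightarrow>
     (\<forall>C. pi_class n Z C \<and> C \<in> null_sets fair_coin_measure \<longrightarrow> X \<notin> C)"

text \<open>A set of pairs \<open>(F, k)\<close> is c.e. via canonical indices of the finite sets \<open>F\<close>.\<close>

definition enumeration_operator :: "(nat set \<times> nat) set \<Rightarrow> bool" where
  "enumeration_operator W \<longleftrightarrow>
     (\<forall>(F, k)\<in>W. finite F) \<and> ce_set ((\<lambda>(F, k). prod_encode (set_encode F, k)) ` W)"

definition enum_apply :: "(nat set \<times> nat) set \<Rightarrow> nat set \<Rightarrow> nat set" where
  "enum_apply W Y = {k. \<exists>F. (F, k) \<in> W \<and> F \<subseteq> Y}"

definition gra :: "(nat \<Rightarrow> nat option) \<Rightarrow> nat set" where
  "gra d = {prod_encode (n, m) | n m. d n = Some m}"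

definition enum_reducible :: "(nat \<Rightarrow> nat option) \<Rightarrow> (nat \<Rightarrow> nat option) \<Rightarrow> bool" where
  "enum_reducible e d \<longleftrightarrow> (\<exists>W. enumeration_operator W \<and> gra e = enum_apply W (gra d))"

definition nd_reducible :: "(nat \<Rightarrow> nat) \<Rightarrow> (nat \<Rightarrow> nat) \<Rightarrow> bool" (infix "\<le>\<^sub>n\<^sub>d" 50) where
  "h \<le>\<^sub>n\<^sub>d g \<longleftrightarrow>
     (\<forall>d. dense_description d g \<longrightarrow> (\<exists>e. dense_description e h \<and> enum_reducible e d))"

definition ud_reducible :: "(nat \<Rightarrow> nat) \<Rightarrow> (nat \<Rightarrow> nat) \<Rightarrow> bool" (infix "\<le>\<^sub>u\<^sub>d" 50) where
  "h \<le>\<^sub>u\<^sub>d g \<longleftrightarrow>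
     (\<exists>W. enumeration_operator W \<and>
        (\<forall>d. dense_description d g \<longrightarrow>
           (\<exists>e. dense_description e h \<and> enum_apply W (gra d) = gra e)))"

end

theory Submission
  imports Defs
begin

text \<open>
  Fix an oracle code \<open>c\<close> and let \<open>C\<close> be the class of all \<open>X\<close> from which \<open>c\<close> computes a dense
  description of \<open>f\<close>. Suppose \<open>\<mu> C > 0\<close> and choose a clopen \<open>B\<close> with \<open>\<mu> (C \<inter> B) > \<mu> B / 2\<close>. Then for
  a density one set of \<open>k\<close> more than half of \<open>B\<close> computes the value \<open>f k\<close>, so a search for the value
  that wins the majority vote inside \<open>B\<close> is an oracle-free dense description of \<open>f\<close>. Hence \<open>\<mu> C = 0\<close>
  if \<open>f\<close> is not densely computable. Moreover \<open>X \<in> C\<close> says that for every \<open>\<epsilon>\<close> there is \<open>N\<close> such that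
  for all \<open>n \<ge> N\<close> there is a stage at which \<open>c\<close> is correct on a fraction \<open>1 - \<epsilon>\<close> of the first \<open>n\<close>
  arguments, so that \<open>C\<close> is a \<open>\<Pi>\<^sub>4\<close> class relative to \<open>f\<close>. Finally, the characteristic function of
  \<open>X\<close> is a dense description of itself, so \<open>A \<le>\<^sub>n\<^sub>d X\<close> gives a dense description of \<open>A\<close> that is
  enumerable, hence computable, from \<open>X\<close>.
\<close>

section \<open>Closure properties of uniformly computable functionals\<close>

text \<open>Countability of the codes turns the union over all codes in
  \<open>null_densely_computable_in\<close> into a countable union of null sets.\<close>

instance recf :: countable
  by countable_datatype

text \<open>
  \<open>ucomp b a F\<close>: one code, total and uniform in the oracle \<open>Z\<close>, computes \<open>F Z e\<close> from the first
  \<open>a\<close> values of the environment \<open>e\<close>; it may query the oracle only if \<open>b\<close>. Decidable relations are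
  functions of the form \<open>of_bool P\<close>. Binding a variable shifts the environment, so that closure
  rules for binders carry no side conditions on arities.
\<close>

definition ucomp :: "bool \<Rightarrow> nat \<Rightarrow> ((nat \<Rightarrow> nat) \<Rightarrow> (nat \<Rightarrow> nat) \<Rightarrow> nat) \<Rightarrow> bool" where
  "ucomp b a F \<longleftrightarrow>
     (\<exists>c. (b \<or> oracle_free c) \<and> (\<forall>Z e. run Z c (map e [0..<a]) = Some (F Z e)))"

lemma ucompI:
  assumes "b \<or> oracle_free c" "\<And>Z e. run Z c (map e [0..<a]) = Some (F Z e)"
  shows "ucomp b a F"
  using assms unfolding ucomp_def by blast

lemma ucomp_var: "i < a \<Longrightarrow> ucomp b a (\<lambda>Z e. e i)"
  by (rule ucompI[where c = "Proj i"]) auto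

lemma ucomp_comp:
  assumes "ucomp b n F" "\<And>i. i < n \<Longrightarrow> ucomp b a (G i)"
  shows "ucomp b a (\<lambda>Z e. F Z (\<lambda>i. G i Z e))"
proof -
  obtain c where c: "b \<or> oracle_free c" "\<And>Z e. run Z c (map e [0..<n]) = Some (F Z e)"
    using assms(1) unfolding ucomp_def by blast
  have "\<forall>i\<in>{..<n}. \<exists>g. (b \<or> oracle_free g) \<and> (\<forall>Z e. run Z g (map e [0..<a]) = Some (G i Z e))"
    using assms(2) unfolding ucomp_def by simp
  then obtain g where g: "\<And>i. i < n \<Longrightarrow> b \<or> oracle_free (g i)"
    "\<And>i Z e. i < n \<Longrightarrow> run Z (g i) (map e [0..<a]) = Some (G i Z e)"
    by (metis bchoice lessThan_iff)
  have m: "map (\<lambda>x. the (run Z x (map e [0..<a]))) (map g [0..<n]) = map (\<lambda>i. G i Z e) [0..<n]" for Z e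
    using g(2) by simp
  have "run Z (Comp c (map g [0..<n])) (map e [0..<a]) = Some (F Z (\<lambda>i. G i Z e))" for Z e
    unfolding run.simps m c(2) using g(2) by simp
  moreover have "b \<or> oracle_free (Comp c (map g [0..<n]))" using g(1) c(1) by auto
  ultimately show ?thesis by (rule ucompI[rotated])
qed

lemma ucomp_reindex:
  assumes "ucomp b n F" "\<And>i. i < n \<Longrightarrow> g i < a"
  shows "ucomp b a (\<lambda>Z e. F Z (\<lambda>i. e (g i)))"
  by (rule ucomp_comp[OF assms(1)]) (simp add: ucomp_var assms(2))

lemma ucomp_comp1:
  assumes "ucomp b 1 (\<lambda>Z e. f Z (e 0))" "ucomp b a F"
  shows "ucomp b a (\<lambda>Z e. f Z (F Z e))"
  using ucomp_comp[OF assms(1), of a "\<lambda>_. F"] assms(2) by simp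

lemma ucomp_comp2:
  assumes "ucomp b 2 (\<lambda>Z e. f Z (e 0) (e 1))" "ucomp b a F" "ucomp b a G"
  shows "ucomp b a (\<lambda>Z e. f Z (F Z e) (G Z e))"
  using ucomp_comp[OF assms(1), of a "\<lambda>i. if i = 0 then F else G"] assms(2,3) by simp

lemma ucomp_comp3:
  assumes "ucomp b 3 (\<lambda>Z e. f Z (e 0) (e 1) (e 2))" "ucomp b a F" "ucomp b a G" "ucomp b a H"
  shows "ucomp b a (\<lambda>Z e. f Z (F Z e) (G Z e) (H Z e))"
  using ucomp_comp[OF assms(1), of a "\<lambda>i. if i = 0 then F else if i = 1 then G else H"] assms(2-4)
  by simp

lemma ucomp_Suc:
  assumes "ucomp b a F" shows "ucomp b a (\<lambda>Z e. Suc (F Z e))"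
proof -
  have "ucomp b 1 (\<lambda>Z e. Suc (e 0))"
    by (rule ucompI[where c = Succ]) auto
  then show ?thesis using ucomp_comp1[where f = "\<lambda>Z. Suc"] assms by simp
qed

lemma ucomp_const: "ucomp b a (\<lambda>Z e. k)"
proof (induction k)
  case 0
  show ?case by (rule ucompI[where c = Zero]) auto
qed (rule ucomp_Suc)

lemma ucomp_query:
  assumes "ucomp True a F" shows "ucomp True a (\<lambda>Z e. Z (F Z e))"
proof -
  have "ucomp True 1 (\<lambda>Z e. Z (e 0))"
    by (rule ucompI[where c = Query]) auto
  then show ?thesis using ucomp_comp1[where f = "\<lambda>Z. Z"] assms by simp
qed

lemma map_upt_Suc_env: "map e [0..<Suc a] = e 0 # map (\<lambda>i. e (Suc i)) [0..<a]"
  by (simp add: upt_conv_Cons map_Suc_upt[symmetric] del: upt_Suc)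

text \<open>All ingredients are total, so the option-valued recursion in \<open>run\<close> never
  meets \<open>None\<close> and collapses to a recursion on numbers. The step sees the counter at
  position 0, the accumulator at position 1, and the environment shifted by two.\<close>

lemma ucomp_rec:
  assumes "ucomp b a B" "ucomp b (Suc (Suc a)) (\<lambda>Z e. G Z (e 0) (e (Suc 0)) (\<lambda>i. e (Suc (Suc i))))"
    and "ucomp b a F"
  shows "ucomp b a (\<lambda>Z e. rec_nat (B Z e) (\<lambda>k v. G Z k v e) (F Z e))"
proof -
  obtain h where h: "b \<or> oracle_free h" "\<And>Z e. run Z h (map e [0..<a]) = Some (B Z e)"
    using assms(1) unfolding ucomp_def by blast
  obtain g where g: "b \<or> oracle_free g" and g': "\<And>Z e. run Z g (map e [0..<Suc (Suc a)]) =
      Some (G Z (e 0) (e (Suc 0)) (\<lambda>i. e (Suc (Suc i))))"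
    using assms(2) unfolding ucomp_def by blast
  have g2: "run Z g (k # v # map e [0..<a]) = Some (G Z k v e)" for Z k v e
    using g'[of Z "case_nat k (case_nat v e)"] by (simp add: map_upt_Suc_env del: upt_Suc)
  have rec: "rec_nat (Some (B Z e)) (\<lambda>k r. case r of None \<Rightarrow> None | Some v \<Rightarrow> Some (G Z k v e)) n =
     Some (rec_nat (B Z e) (\<lambda>k v. G Z k v e) n)" for Z e n
    by (induction n) auto
  \<comment> \<open>\<open>PrimRec\<close> recurses on its first argument, so the recursion bound is
    first a fresh variable at position 0, for which \<open>F\<close> is then substituted.\<close>
  have "ucomp b (Suc a) (\<lambda>Z e. rec_nat (B Z (\<lambda>i. e (Suc i))) (\<lambda>k v. G Z k v (\<lambda>i. e (Suc i))) (e 0))"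
    using h(1) g
    by (intro ucompI[where c = "PrimRec h g"])
      (auto simp: map_upt_Suc_env h(2) g2 rec simp del: upt_Suc)
  from ucomp_comp[OF this, of a "\<lambda>i. case i of 0 \<Rightarrow> F | Suc j \<Rightarrow> (\<lambda>Z e. e j)"] show ?thesis
    using assms(3) by (auto simp: ucomp_var split: nat.splits)
qed

lemma ucomp_plus:
  assumes "ucomp b a F" "ucomp b a G" shows "ucomp b a (\<lambda>Z e. F Z e + G Z e)"
proof -
  have eq: "rec_nat m (\<lambda>k v. Suc v) n = m + n" for m n :: nat by (induction n) auto
  have "ucomp b 2 (\<lambda>Z e. rec_nat (e 0) (\<lambda>k v. Suc v) (e 1))"
    by (intro ucomp_rec ucomp_Suc ucomp_var) auto
  then show ?thesis using ucomp_comp2[OF _ assms, of "\<lambda>Z. (+)"] by (simp add: eq)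
qed

lemma ucomp_mult:
  assumes "ucomp b a F" "ucomp b a G" shows "ucomp b a (\<lambda>Z e. F Z e * G Z e)"
proof -
  have eq: "rec_nat 0 (\<lambda>k v. v + m) n = m * n" for m n :: nat by (induction n) auto
  have "ucomp b 2 (\<lambda>Z e. rec_nat 0 (\<lambda>k v. v + e 0) (e 1))"
    by (intro ucomp_rec ucomp_plus ucomp_var ucomp_const) auto
  then show ?thesis using ucomp_comp2[OF _ assms, of "\<lambda>Z. (*)"] by (simp add: eq)
qed

lemma ucomp_power:
  assumes "ucomp b a F" "ucomp b a G" shows "ucomp b a (\<lambda>Z e. F Z e ^ G Z e)"
proof -
  have eq: "rec_nat 1 (\<lambda>k v. v * m) n = m ^ n" for m n :: nat by (induction n) auto
  have "ucomp b 2 (\<lambda>Z e. rec_nat 1 (\<lambda>k v. v * e 0) (e 1))"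
    by (intro ucomp_rec ucomp_mult ucomp_var ucomp_const) auto
  then show ?thesis using ucomp_comp2[OF _ assms, of "\<lambda>Z. (^)"] by (simp add: eq[simplified])
qed

lemma ucomp_minus:
  assumes "ucomp b a F" "ucomp b a G" shows "ucomp b a (\<lambda>Z e. F Z e - G Z e)"
proof -
  have pred: "rec_nat 0 (\<lambda>k v. k) n = n - 1" for n :: nat by (cases n) auto
  have "ucomp b 1 (\<lambda>Z e. rec_nat 0 (\<lambda>k v. k) (e 0))"
    by (intro ucomp_rec ucomp_var ucomp_const) auto
  then have p: "ucomp b 1 (\<lambda>Z e. e 0 - 1)" by (simp add: pred)
  have eq: "rec_nat m (\<lambda>k v. v - 1) n = m - n" for m n :: nat by (induction n) auto
  have "ucomp b 2 (\<lambda>Z e. rec_nat (e 0) (\<lambda>k v. v - 1) (e 1))"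
    by (intro ucomp_rec ucomp_comp1[OF p] ucomp_var) auto
  then show ?thesis using ucomp_comp2[OF _ assms, of "\<lambda>Z. (-)"] by (simp add: eq[simplified])
qed

lemma ucomp_sum:
  assumes "ucomp b a G" "ucomp b (Suc a) (\<lambda>Z e. F Z (e 0) (\<lambda>i. e (Suc i)))"
  shows "ucomp b a (\<lambda>Z e. \<Sum>k<G Z e. F Z k e)"
proof -
  have eq: "rec_nat 0 (\<lambda>k v. v + h k) n = (\<Sum>k<n. h k)" for n and h :: "nat \<Rightarrow> nat"
    by (induction n) auto
  \<comment> \<open>The recursion also binds the accumulator at position 1; the reindexing makes the
    summand skip it.\<close>
  have "ucomp b (Suc (Suc a)) (\<lambda>Z e. F Z (e 0) (\<lambda>i. e (Suc (Suc i))))"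
    using ucomp_reindex[OF assms(2), of "\<lambda>i. if i = 0 then 0 else Suc i"] by simp
  then have "ucomp b a (\<lambda>Z e. rec_nat 0 (\<lambda>k v. v + F Z k e) (G Z e))"
    by (intro ucomp_rec ucomp_plus ucomp_var ucomp_const assms) auto
  then show ?thesis by (simp add: eq)
qed

section \<open>Decidable relations, bounded quantifiers and coding\<close>

lemma ucomp_not:
  assumes "ucomp b a (\<lambda>Z e. of_bool (P Z e))"
  shows "ucomp b a (\<lambda>Z e. of_bool (\<not> P Z e))"
proof -
  have "1 - of_bool p = (of_bool (\<not> p) :: nat)" for p by simp
  with ucomp_minus[OF ucomp_const[of b a 1] assms] show ?thesis by simp
qed

lemma ucomp_conj:
  assumes "ucomp b a (\<lambda>Z e. of_bool (P Z e))" "ucomp b a (\<lambda>Z e. of_bool (Q Z e))"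
  shows "ucomp b a (\<lambda>Z e. of_bool (P Z e \<and> Q Z e))"
  using ucomp_mult[OF assms] by (simp add: of_bool_conj)

lemma ucomp_disj:
  assumes "ucomp b a (\<lambda>Z e. of_bool (P Z e))" "ucomp b a (\<lambda>Z e. of_bool (Q Z e))"
  shows "ucomp b a (\<lambda>Z e. of_bool (P Z e \<or> Q Z e))"
  using ucomp_not[OF ucomp_conj[OF ucomp_not[OF assms(1)] ucomp_not[OF assms(2)]]] by simp

lemma ucomp_le:
  assumes "ucomp b a F" "ucomp b a G"
  shows "ucomp b a (\<lambda>Z e. of_bool (F Z e \<le> G Z e))"
proof -
  \<comment> \<open>Truncated subtraction: the inner difference vanishes exactly when
    \<open>m \<le> n\<close>.\<close>
  have "1 - (m - n) = of_bool (m \<le> n)" for m n :: nat by auto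
  with ucomp_minus[OF ucomp_const[of b a 1] ucomp_minus[OF assms]] show ?thesis by simp
qed

lemma ucomp_less:
  assumes "ucomp b a F" "ucomp b a G"
  shows "ucomp b a (\<lambda>Z e. of_bool (F Z e < G Z e))"
  using ucomp_le[OF ucomp_Suc[OF assms(1)] assms(2)] by (simp add: Suc_le_eq)

lemma ucomp_eq:
  assumes "ucomp b a F" "ucomp b a G"
  shows "ucomp b a (\<lambda>Z e. of_bool (F Z e = G Z e))"
  using ucomp_conj[OF ucomp_le[OF assms] ucomp_le[OF assms(2,1)]] by (simp add: eq_iff)

lemma ucomp_ex:
  assumes "ucomp b a G" "ucomp b (Suc a) (\<lambda>Z e. of_bool (P Z (e 0) (\<lambda>i. e (Suc i))))"
  shows "ucomp b a (\<lambda>Z e. of_bool (\<exists>k<G Z e. P Z k e))"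
proof -
  have "(0 < (\<Sum>k<n. of_bool (p k) :: nat)) = (\<exists>k<n. p k)" for n and p :: "nat \<Rightarrow> bool"
    by (induction n) (auto simp: less_Suc_eq)
  with ucomp_less[OF ucomp_const[of b a 0] ucomp_sum[OF assms]] show ?thesis by simp
qed

lemma ucomp_all:
  assumes "ucomp b a G" "ucomp b (Suc a) (\<lambda>Z e. of_bool (P Z (e 0) (\<lambda>i. e (Suc i))))"
  shows "ucomp b a (\<lambda>Z e. of_bool (\<forall>k<G Z e. P Z k e))"
  using ucomp_not[OF ucomp_ex[OF assms(1) ucomp_not[OF assms(2)]]] by simp

lemma ucomp_if:
  assumes "ucomp b a (\<lambda>Z e. of_bool (P Z e))" "ucomp b a F" "ucomp b a G"
  shows "ucomp b a (\<lambda>Z e. if P Z e then F Z e else G Z e)"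
proof -
  have eq: "(if p then m else n) = of_bool p * m + of_bool (\<not> p) * n" for p and m n :: nat by auto
  show ?thesis unfolding eq by (intro ucomp_plus ucomp_mult ucomp_not assms)
qed

lemma ucomp_div:
  assumes "ucomp b a F" "ucomp b a G"
  shows "ucomp b a (\<lambda>Z e. F Z e div G Z e)"
proof -
  \<comment> \<open>The quotient counts the positive multiples of \<open>n\<close> up to
    \<open>m\<close>. For \<open>n = 0\<close> that count would be \<open>m\<close>, whereas
    division by zero gives 0.\<close>
  have eq: "(if n = 0 then 0 else \<Sum>k<m. of_bool (Suc k * n \<le> m)) = m div n" for m n :: nat
  proof (cases "n = 0")
    case False
    have "k < m" if "Suc k * n \<le> m" for k
      using that False by (metis Suc_le_eq mult_le_mono2 mult.right_neutral order_trans not0_implies_Suc le_add1 plus_1_eq_Suc)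
    then have "{k. k < m \<and> Suc k * n \<le> m} = {..<m div n}"
      using False by (auto simp: less_eq_div_iff_mult_less_eq Suc_le_eq[symmetric] simp del: mult_Suc)
    then have "card {k. k < m \<and> Suc k * n \<le> m} = m div n" by simp
    moreover have "{..<m} \<inter> {k. Suc k * n \<le> m} = {k. k < m \<and> Suc k * n \<le> m}" by auto
    ultimately show ?thesis using False by (simp del: mult_Suc)
  qed simp
  have "ucomp b 2 (\<lambda>Z e. if e 1 = 0 then 0 else \<Sum>k<e 0. of_bool (Suc k * e 1 \<le> e 0))"
    by (intro ucomp_if ucomp_sum ucomp_le ucomp_eq ucomp_mult ucomp_Suc ucomp_var ucomp_const) auto
  then show ?thesis using ucomp_comp2[OF _ assms, of "\<lambda>Z. (div)"] by (simp only: eq)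
qed

lemma ucomp_mod:
  assumes "ucomp b a F" "ucomp b a G"
  shows "ucomp b a (\<lambda>Z e. F Z e mod G Z e)"
  using ucomp_minus[OF assms(1) ucomp_mult[OF ucomp_div[OF assms] assms(2)]]
  by (simp add: minus_div_mult_eq_mod)

lemma ucomp_odd:
  assumes "ucomp b a F"
  shows "ucomp b a (\<lambda>Z e. of_bool (odd (F Z e)))"
  using ucomp_mod[OF assms ucomp_const[of b a 2]] by (simp add: mod_2_eq_odd)

lemma ucomp_prod_encode:
  assumes "ucomp b a F" "ucomp b a G"
  shows "ucomp b a (\<lambda>Z e. prod_encode (F Z e, G Z e))"
  unfolding prod_encode_def triangle_def prod.case
  by (intro ucomp_plus ucomp_div ucomp_mult ucomp_Suc ucomp_const assms)

lemmas ucomp_intros =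
  ucomp_var ucomp_const ucomp_Suc ucomp_plus ucomp_minus ucomp_mult ucomp_power ucomp_div ucomp_mod
  ucomp_prod_encode ucomp_sum ucomp_if ucomp_not ucomp_conj ucomp_disj ucomp_le ucomp_less ucomp_eq
  ucomp_ex ucomp_all ucomp_odd

text \<open>Only the stage \<open>t\<close> is minimised; the answer \<open>m\<close> is sought
  below \<open>t\<close>. Uniqueness is assumed across all stages, so the least successful stage
  already yields the intended value.\<close>

lemma ucomp_search:
  assumes P: "ucomp b 3 (\<lambda>Z e. of_bool (P Z (e 0) (e 1) (e 2)))"
  obtains c where "b \<or> oracle_free c"
    "\<And>Z n t m. \<lbrakk>m < t; P Z t m n; \<And>t' m'. m' < t' \<Longrightarrow> P Z t' m' n \<Longrightarrow> m' = m\<rbrakk> \<Longrightarrow> run Z c [n] = Some m"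
proof -
  \<comment> \<open>The test is negated because \<open>Mu\<close> looks for a zero.\<close>
  have T: "ucomp b 2 (\<lambda>Z e. of_bool (\<not> (\<exists>m<e 0. P Z (e 0) m (e 1))))"
    by (intro ucomp_intros ucomp_comp3[OF P]) auto
  obtain h where h: "b \<or> oracle_free h"
    "\<And>Z e. run Z h (map e [0..<2]) = Some (of_bool (\<not> (\<exists>m<e 0. P Z (e 0) m (e 1))))"
    using T unfolding ucomp_def by blast
  \<comment> \<open>With exactly one witness below the stage, the sum of all witnesses is that
    witness.\<close>
  have V: "ucomp b 2 (\<lambda>Z e. \<Sum>m<e 0. m * of_bool (P Z (e 0) m (e 1)))"
    by (intro ucomp_intros ucomp_comp3[OF P]) auto
  obtain v where v: "b \<or> oracle_free v"
    "\<And>Z e. run Z v (map e [0..<2]) = Some (\<Sum>m<e 0. m * of_bool (P Z (e 0) m (e 1)))"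
    using V unfolding ucomp_def by blast
  have upt2: "[0..<2] = [0, Suc 0]" by (simp add: upt_rec)
  have h': "run Z h [t, n] = Some (of_bool (\<not> (\<exists>m<t. P Z t m n)))" for Z t n
    using h(2)[of Z "\<lambda>i. if i = 0 then t else n"] by (simp add: upt2)
  have v': "run Z v [t, n] = Some (\<Sum>m<t. m * of_bool (P Z t m n))" for Z t n
    using v(2)[of Z "\<lambda>i. if i = 0 then t else n"] by (simp add: upt2)
  show ?thesis
  proof (rule that[of "Comp v [Mu h, Proj 0]"])
    show "b \<or> oracle_free (Comp v [Mu h, Proj 0])" using h(1) v(1) by auto
  next
    fix Z n t m
    assume mt: "m < t" "P Z t m n" and uniq: "\<And>t' m'. m' < t' \<Longrightarrow> P Z t' m' n \<Longrightarrow> m' = m"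
    define t0 where "t0 = (LEAST t. \<exists>m<t. P Z t m n)"
    have "\<exists>m<t0. P Z t0 m n" unfolding t0_def by (rule LeastI_ex) (use mt in blast)
    then have m: "m < t0" "P Z t0 m n" using uniq by blast+
    have h0: "run Z h [k, n] = Some 0 \<longleftrightarrow> (\<exists>m<k. P Z k m n)" for k
      by (simp add: h')
    have "\<exists>k. run Z h [k, n] = Some 0 \<and> (\<forall>m<k. run Z h [m, n] \<noteq> None)"
      using mt unfolding h0 by (auto simp: h')
    then have mu: "run Z (Mu h) [n] = Some t0"
      by (simp only: run.simps if_True h0 t0_def)
    have "P Z t0 k n \<longleftrightarrow> k = m" if "k < t0" for k
      using that m uniq by blast
    then have "(\<Sum>k<t0. k * of_bool (P Z t0 k n)) = (\<Sum>k<t0. if k = m then k else 0)"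
      by (intro sum.cong) auto
    also have "\<dots> = m" using m(1) by simp
    finally have "run Z v [t0, n] = Some m" by (simp add: v')
    then show "run Z (Comp v [Mu h, Proj 0]) [n] = Some m"
      using mu by (simp del: run.simps(7))
  qed
qed

section \<open>Step-bounded evaluation\<close>

text \<open>
  Evaluation in which every query and every minimisation is bounded by \<open>s\<close>. The value \<open>0\<close> stands
  for \<^const>\<open>None\<close> and \<open>Suc v\<close> for \<^term>\<open>Some v\<close>.
\<close>

fun srun :: "(nat \<Rightarrow> nat) \<Rightarrow> nat \<Rightarrow> recf \<Rightarrow> nat list \<Rightarrow> nat" where
  "srun Z s Zero xs = 1"
| "srun Z s Succ xs = (case xs of [x] \<Rightarrow> Suc (Suc x) | _ \<Rightarrow> 0)"
| "srun Z s (Proj i) xs = (if i < length xs then Suc (xs ! i) else 0)"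
| "srun Z s Query xs = (case xs of [x] \<Rightarrow> if x < s then Suc (Z x) else 0 | _ \<Rightarrow> 0)"
| "srun Z s (Comp h gs) xs =
     (if \<forall>g\<in>set gs. srun Z s g xs \<noteq> 0 then srun Z s h (map (\<lambda>g. srun Z s g xs - 1) gs) else 0)"
| "srun Z s (PrimRec h g) xs =
     (case xs of
        [] \<Rightarrow> 0
      | n # ys \<Rightarrow>
          rec_nat (srun Z s h ys)
            (\<lambda>k r. if r = 0 then 0 else srun Z s g (k # (r - 1) # ys)) n)"
| "srun Z s (Mu h) xs =
     (\<Sum>n<s. if srun Z s h (n # xs) = 1 \<and> (\<forall>m<n. 1 < srun Z s h (m # xs)) then Suc n else 0)"

text \<open>Queries at or beyond \<open>s\<close> are undefined in \<open>srun\<close>. Hence a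
  finite string can stand in for the oracle, and events about \<open>srun\<close> are
  clopen.\<close>

lemma srun_cong:
  assumes "\<And>x. x < s \<Longrightarrow> Z x = Z' x"
  shows "srun Z s c xs = srun Z' s c xs"
proof (induction c arbitrary: xs)
  case Query
  show ?case using assms by (auto split: list.splits)
next
  case (Comp h gs)
  have m: "map (\<lambda>g. srun Z s g xs - 1) gs = map (\<lambda>g. srun Z' s g xs - 1) gs"
    using Comp.IH(2) by simp
  show ?case unfolding srun.simps Comp.IH(1) m using Comp.IH(2) by simp
next
  case (PrimRec h g)
  show ?case unfolding srun.simps PrimRec.IH ..
qed auto

lemma srun_sound: "srun Z s c xs = Suc v \<Longrightarrow> run Z c xs = Some v"
proof (induction c arbitrary: xs v)
  case (Comp h gs)
  have all: "\<forall>g\<in>set gs. srun Z s g xs \<noteq> 0"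
    and h: "srun Z s h (map (\<lambda>g. srun Z s g xs - 1) gs) = Suc v"
    using Comp.prems by (auto split: if_splits)
  have g: "run Z g xs = Some (srun Z s g xs - 1)" if "g \<in> set gs" for g
    using Comp.IH(2)[OF that] all that by (metis not0_implies_Suc diff_Suc_1)
  have m: "map (\<lambda>g. the (run Z g xs)) gs = map (\<lambda>g. srun Z s g xs - 1) gs"
    using g by simp
  show ?case unfolding run.simps m using g Comp.IH(1)[OF h] by simp
next
  case (PrimRec h g)
  then obtain n ys where xs: "xs = n # ys" by (auto split: list.splits)
  have "rec_nat (srun Z s h ys) (\<lambda>k r. if r = 0 then 0 else srun Z s g (k # (r - 1) # ys)) n = Suc v"
    using PrimRec.prems xs by simp
  then have "rec_nat (run Z h ys)
            (\<lambda>k r. case r of None \<Rightarrow> None | Some v \<Rightarrow> run Z g (k # v # ys)) n = Some v"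
  proof (induction n arbitrary: v)
    case 0
    then show ?case using PrimRec.IH(1) by simp
  next
    case (Suc n)
    let ?r = "rec_nat (srun Z s h ys) (\<lambda>k r. if r = 0 then 0 else srun Z s g (k # (r - 1) # ys)) n"
    have "?r \<noteq> 0" and *: "srun Z s g (n # (?r - 1) # ys) = Suc v"
      using Suc.prems by (auto split: if_splits)
    then have "?r = Suc (?r - 1)" by simp
    from Suc.IH[OF this] PrimRec.IH(2)[OF *] show ?case by simp
  qed
  then show ?case by (simp add: xs)
next
  case (Mu h)
  let ?P = "\<lambda>n. srun Z s h (n # xs) = 1 \<and> (\<forall>m<n. 1 < srun Z s h (m # xs))"
  \<comment> \<open>At most one term of this sum is nonzero: \<open>?P\<close> singles out the first
    zero preceded by defined positive values only.\<close>
  have "(\<Sum>n<s. if ?P n then Suc n else 0) \<noteq> 0" using Mu.prems by simp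
  then obtain n where n: "n < s" "?P n"
    by (rule sum.not_neutral_contains_not_neutral) (auto split: if_splits)
  have "?P k \<longleftrightarrow> k = n" for k
    using n by (metis less_irrefl nat_neq_iff)
  then have "(\<Sum>n<s. if ?P n then Suc n else 0) = Suc n" using n(1) by simp
  then have v: "v = n" using Mu.prems by simp
  have 0: "run Z h (n # xs) = Some 0" using Mu.IH n by simp
  have m: "\<exists>w. run Z h (m # xs) = Some (Suc w)" if "m < n" for m
  proof -
    from n(2) that have "srun Z s h (m # xs) = Suc (Suc (srun Z s h (m # xs) - 2))" by force
    from Mu.IH[OF this] show ?thesis by blast
  qed
  have "(LEAST n. run Z h (n # xs) = Some 0) = n"
  proof (rule Least_equality)
    show "run Z h (n # xs) = Some 0" by (rule 0)
    fix k assume "run Z h (k # xs) = Some 0"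
    with m[of k] show "n \<le> k" by (cases "k < n") auto
  qed
  then show ?case using 0 m v by fastforce
qed (auto split: list.splits if_splits)

text \<open>Convergence at all large stages, rather than at one, lets finitely many subcomputations
  share a stage by intersecting their tails.\<close>

lemma srun_complete:
  "run Z c xs = Some v \<Longrightarrow> \<forall>\<^sub>F s in sequentially. srun Z s c xs = Suc v"
proof (induction c arbitrary: xs v)
  case Query
  then show ?case
    by (auto split: list.splits intro: eventually_mono[OF eventually_gt_at_top])
next
  case (Comp h gs)
  have g: "run Z g xs = Some (the (run Z g xs))" if "g \<in> set gs" for g
    using Comp.prems that by (auto split: if_splits)
  have "run Z h (map (\<lambda>g. the (run Z g xs)) gs) = Some v"
    using Comp.prems by (auto split: if_splits)
  then have "\<forall>\<^sub>F s in sequentially. srun Z s h (map (\<lambda>g. the (run Z g xs)) gs) = Suc v"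
    by (rule Comp.IH)
  moreover have "\<forall>\<^sub>F s in sequentially. \<forall>g\<in>set gs. srun Z s g xs = Suc (the (run Z g xs))"
    using Comp.IH(2) g by (intro eventually_ball_finite) blast+
  ultimately show ?case
  proof eventually_elim
    case (elim s)
    have m: "map (\<lambda>g. srun Z s g xs - 1) gs = map (\<lambda>g. the (run Z g xs)) gs"
      using elim by simp
    show ?case unfolding srun.simps m using elim by simp
  qed
next
  case (PrimRec h g)
  then obtain n ys where xs: "xs = n # ys" by (auto split: list.splits)
  have "rec_nat (run Z h ys)
            (\<lambda>k r. case r of None \<Rightarrow> None | Some v \<Rightarrow> run Z g (k # v # ys)) n = Some v"
    using PrimRec.prems xs by simp
  then have "\<forall>\<^sub>F s in sequentially.
    rec_nat (srun Z s h ys) (\<lambda>k r. if r = 0 then 0 else srun Z s g (k # (r - 1) # ys)) n = Suc v"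
  proof (induction n arbitrary: v)
    case 0
    then show ?case using PrimRec.IH(1) by simp
  next
    case (Suc n)
    then obtain w where w: "rec_nat (run Z h ys)
            (\<lambda>k r. case r of None \<Rightarrow> None | Some v \<Rightarrow> run Z g (k # v # ys)) n = Some w"
        "run Z g (n # w # ys) = Some v"
      by (auto split: option.splits)
    from Suc.IH[OF w(1)] PrimRec.IH(2)[OF w(2)] show ?case
      by eventually_elim simp
  qed
  then show ?case by (simp add: xs)
next
  case (Mu h)
  from Mu.prems obtain n where n: "run Z h (n # xs) = Some 0" "\<forall>m<n. run Z h (m # xs) \<noteq> None"
    and v: "v = (LEAST n. run Z h (n # xs) = Some 0)"
    by (auto split: if_splits)
  have v0: "run Z h (v # xs) = Some 0" unfolding v by (rule LeastI) (rule n(1))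
  have "v \<le> n" unfolding v by (rule Least_le) (rule n(1))
  have m: "\<exists>w. run Z h (m # xs) = Some (Suc w)" if "m < v" for m
    using n(2) \<open>v \<le> n\<close> that not_less_Least[OF that[unfolded v]]
    by (metis not0_implies_Suc not_None_eq order_less_le_trans)
  have "\<forall>\<^sub>F s in sequentially. \<forall>m\<in>{..<v}. 1 < srun Z s h (m # xs)"
  proof (intro eventually_ball_finite ballI)
    fix k assume "k \<in> {..<v}"
    then obtain w where "run Z h (k # xs) = Some (Suc w)" using m by auto
    from Mu.IH[OF this] show "\<forall>\<^sub>F s in sequentially. 1 < srun Z s h (k # xs)"
      by eventually_elim simp
  qed simp
  with Mu.IH[OF v0] eventually_gt_at_top[of v] show ?case
  proof eventually_elim
    case (elim s)
    let ?P = "\<lambda>n. srun Z s h (n # xs) = 1 \<and> (\<forall>m<n. 1 < srun Z s h (m # xs))"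
    have P: "?P v" using elim by simp
    have "?P k \<longleftrightarrow> k = v" for k
      using P by (metis less_irrefl nat_neq_iff)
    then have "(\<Sum>n<s. if ?P n then Suc n else 0) = Suc v" using elim(2) by simp
    then show ?case by simp
  qed
qed (auto split: list.splits if_splits)

lemma map_upt_add2_env: "map (\<lambda>i. e (i + 2)) [0..<Suc a] = e 2 # map (\<lambda>i. e (i + 3)) [0..<a]"
  by (subst map_upt_Suc_env) (simp add: numeral_3_eq_3 numeral_2_eq_2)

text \<open>Position 0 holds the stage, position 1 a parameter of the simulated oracle, and the rest
  the argument list. Induction on the fixed code builds one program per code in place of a universal
  machine. Since the oracle is itself given by \<open>Q\<close>, the result is oracle-free when
  \<open>Q\<close> is.\<close>

lemma ucomp_srun:
  assumes Q: "ucomp b 2 (\<lambda>Z e. Q Z (e 0) (e 1))"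
  shows "ucomp b (a + 2) (\<lambda>Z e. srun (Q Z (e 1)) (e 0) c (map (\<lambda>i. e (i + 2)) [0..<a]))"
proof (induction c arbitrary: a)
  case Zero
  show ?case by (simp add: ucomp_const del: One_nat_def)
next
  case Succ
  consider "a = 1" | "a \<noteq> 1" by blast
  then show ?case
  proof cases
    case 1
    then show ?thesis by (simp add: numeral_2_eq_2) (intro ucomp_intros; simp)
  next
    case 2
    then have eq: "(case map (\<lambda>i. e (i + 2)) [0..<a] of [x] \<Rightarrow> Suc (Suc x) | _ \<Rightarrow> 0) = 0" for e
      by (auto split: list.split dest: arg_cong[where f = length])
    show ?thesis unfolding srun.simps eq by (rule ucomp_const)
  qed
next
  case (Proj i)
  show ?case
    by (cases "i < a") (auto intro!: ucomp_intros)
next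
  case Query
  consider "a = 1" | "a \<noteq> 1" by blast
  then show ?case
  proof cases
    case 1
    have "ucomp b 3 (\<lambda>Z e. if e 2 < e 0 then Suc (Q Z (e 1) (e 2)) else 0)"
      by (intro ucomp_intros ucomp_comp2[OF Q]) auto
    then show ?thesis using 1 by (simp add: eval_nat_numeral cong: if_cong)
  next
    case 2
    then have eq: "(case map (\<lambda>i. e (i + 2)) [0..<a] of [x] \<Rightarrow> if x < s then Suc (q x) else 0 | _ \<Rightarrow> 0) = 0"
      for e s and q :: "nat \<Rightarrow> nat"
      by (auto split: list.split dest: arg_cong[where f = length])
    show ?thesis unfolding srun.simps eq by (rule ucomp_const)
  qed
next
  case (Comp h gs)
  let ?G = "\<lambda>g Z e. srun (Q Z (e 1)) (e 0) g (map (\<lambda>i. e (i + 2)) [0..<a])"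
  have all: "ucomp b (a + 2) (\<lambda>Z e. of_bool (\<forall>g\<in>set hs. ?G g Z e \<noteq> 0))" if "set hs \<subseteq> set gs" for hs
    using that
  proof (induction hs)
    case Nil
    show ?case by (simp add: ucomp_const[where k = 1, simplified])
  next
    case (Cons g hs)
    have "ucomp b (a + 2) (\<lambda>Z e. of_bool (?G g Z e \<noteq> 0 \<and> (\<forall>g\<in>set hs. ?G g Z e \<noteq> 0)))"
      using Cons Comp.IH(2)[of g a] by (intro ucomp_intros) auto
    then show ?case by simp
  qed
  have eq: "map (\<lambda>i. f (gs ! i)) [0..<length gs] = map f gs" for f :: "recf \<Rightarrow> nat"
    by (rule nth_equalityI) auto
  \<comment> \<open>Stage and parameter are passed through; the remaining entries are the values of
    the inner codes, with the offset 1 of the option coding removed.\<close>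
  define G' :: "nat \<Rightarrow> (nat \<Rightarrow> nat) \<Rightarrow> (nat \<Rightarrow> nat) \<Rightarrow> nat" where "G' i = (if i = 0 then (\<lambda>Z e. e 0) else if i = 1 then (\<lambda>Z e. e 1)
      else (\<lambda>Z e. ?G (gs ! (i - 2)) Z e - 1))" for i
  have "ucomp b (a + 2) (G' i)" if "i < length gs + 2" for i
    unfolding G'_def using that Comp.IH(2)[of "gs ! (i - 2)" a]
    by (auto intro!: ucomp_var ucomp_minus ucomp_const)
  from ucomp_comp[OF Comp.IH(1)[of "length gs"], where G = G', OF this]
  have "ucomp b (a + 2) (\<lambda>Z e. srun (Q Z (e 1)) (e 0) h (map (\<lambda>i. ?G (gs ! i) Z e - 1) [0..<length gs]))"
    by (simp add: G'_def)
  then have "ucomp b (a + 2) (\<lambda>Z e. srun (Q Z (e 1)) (e 0) h (map (\<lambda>g. ?G g Z e - 1) gs))"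
    by (simp only: eq[of "\<lambda>g. ?G g _ _ - 1"])
  with all[OF order_refl] show ?case
    unfolding srun.simps by (intro ucomp_if ucomp_const)
next
  case (PrimRec h g)
  show ?case
  proof (cases a)
    case 0
    then show ?thesis by (simp add: ucomp_const)
  next
    case (Suc a')
    let ?ys = "\<lambda>e. map (\<lambda>i. e (i + 3)) [0..<a']"
    \<comment> \<open>The base case runs on the tail of the argument list, so position 2, the
      recursion bound, is skipped.\<close>
    have h: "ucomp b (a + 2) (\<lambda>Z e. srun (Q Z (e 1)) (e 0) h (?ys e))"
      using ucomp_reindex[OF PrimRec.IH(1)[of a'], of "\<lambda>i. if i < 2 then i else Suc i" "a + 2"]
      by (simp add: Suc eval_nat_numeral)
    \<comment> \<open>Two bound variables now precede the environment: stage and parameter sit at 2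
      and 3, counter and coded accumulator at 0 and 1, and position 4 is the skipped recursion
      bound.\<close>
    define G' :: "nat \<Rightarrow> (nat \<Rightarrow> nat) \<Rightarrow> (nat \<Rightarrow> nat) \<Rightarrow> nat" where "G' i = (if i < 2 then (\<lambda>Z e. e (i + 2)) else if i = 2 then (\<lambda>Z e. e 0)
        else if i = 3 then (\<lambda>Z e. e 1 - 1) else (\<lambda>Z e. e (i + 1)))" for i
    have "ucomp b (Suc (Suc (a + 2))) (G' i)" if "i < Suc (Suc a') + 2" for i
      unfolding G'_def using that by (auto simp: Suc intro!: ucomp_var ucomp_minus ucomp_const)
    from ucomp_comp[OF PrimRec.IH(2)[of "Suc (Suc a')"], where G = G', OF this]
    have "ucomp b (Suc (Suc (a + 2))) (\<lambda>Z e. srun (Q Z (e 3)) (e 2) g (e 0 # (e 1 - 1) # map (\<lambda>i. e (i + 5)) [0..<a']))"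
      by (simp add: G'_def map_upt_Suc_env eval_nat_numeral del: upt_Suc)
    then have g: "ucomp b (Suc (Suc (a + 2))) (\<lambda>Z e. if e (Suc 0) = 0 then 0 else
        srun (Q Z (e (Suc (Suc 1)))) (e (Suc (Suc 0))) g
          (e 0 # (e (Suc 0) - 1) # map (\<lambda>i. e (Suc (Suc (i + 3)))) [0..<a']))"
      by (intro ucomp_intros) (simp_all add: eval_nat_numeral)
    have "ucomp b (a + 2) (\<lambda>Z e. rec_nat (srun (Q Z (e 1)) (e 0) h (?ys e))
       (\<lambda>k r. if r = 0 then 0 else srun (Q Z (e 1)) (e 0) g (k # (r - 1) # ?ys e)) (e 2))"
      by (intro ucomp_rec h g ucomp_var) (simp add: Suc)
    then show ?thesis unfolding Suc map_upt_add2_env srun.simps list.case .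
  qed
next
  case (Mu h)
  \<comment> \<open>The bound variable of the minimisation sits at position 0 but has to become the
    first argument of \<open>h\<close>, behind stage and parameter.\<close>
  have "ucomp b (Suc (a + 2)) (\<lambda>Z e. srun (Q Z (e 2)) (e 1) h (e 0 # map (\<lambda>i. e (i + 3)) [0..<a]))"
    using ucomp_reindex[OF Mu.IH[of "Suc a"], of "\<lambda>i. if i < 2 then Suc i else if i = 2 then 0 else i" "Suc (a + 2)"]
    by (simp add: map_upt_Suc_env eval_nat_numeral del: upt_Suc)
  then have h1: "ucomp b (Suc (a + 2)) (\<lambda>Z e. srun (Q Z (e (Suc 1))) (e (Suc 0)) h
      (e 0 # map (\<lambda>i. e (Suc (i + 2))) [0..<a]))"
    by (simp add: eval_nat_numeral)
  have "ucomp b (Suc (Suc (a + 2))) (\<lambda>Z e. srun (Q Z (e (Suc (Suc 1)))) (e (Suc (Suc 0))) h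
      (e 0 # map (\<lambda>i. e (Suc (Suc (i + 2)))) [0..<a]))"
    using ucomp_reindex[OF h1, of "\<lambda>i. if i = 0 then 0 else Suc i" "Suc (Suc (a + 2))"] by simp
  note h2 = this
  show ?case unfolding srun.simps
    apply (rule ucomp_sum)
     apply (rule ucomp_var, simp)
    apply (rule ucomp_if)
      apply (rule ucomp_conj)
       apply (rule ucomp_eq[OF h1 ucomp_const])
      apply (rule ucomp_all)
       apply (rule ucomp_var, simp)
      apply (rule ucomp_less[OF ucomp_const h2])
     apply (rule ucomp_Suc, rule ucomp_var, simp)
    apply (rule ucomp_const)
    done
qed

section \<open>Coin flips and clopen sets\<close>

abbreviation coin_flips :: "(nat \<Rightarrow> bool) measure" where
  "coin_flips \<equiv> PiM UNIV (\<lambda>_. measure_pmf (bernoulli_pmf (1 / 2)))"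

interpretation coin: product_prob_space "\<lambda>_ :: nat. measure_pmf (bernoulli_pmf (1 / 2))" UNIV
  by (intro product_prob_spaceI prob_space_measure_pmf)

lemma space_coin_flips [simp]: "space coin_flips = UNIV"
  by (simp add: space_PiM)

text \<open>Strings of length \<open>s\<close> become the numbers below \<open>2 ^ s\<close>, so
  that measuring a clopen set amounts to a bounded sum.\<close>

definition prefix_code :: "nat \<Rightarrow> (nat \<Rightarrow> bool) \<Rightarrow> nat" where
  "prefix_code s X = set_encode {i. i < s \<and> X i}"

lemma odd_prefix_code_div: "odd (prefix_code s X div 2 ^ i) \<longleftrightarrow> i < s \<and> X i"
proof -
  have "set_decode (prefix_code s X) = {i. i < s \<and> X i}"
    unfolding prefix_code_def by (simp add: set_encode_inverse)
  then show ?thesis by (auto simp: set_decode_def)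
qed

lemma nat_eqI_binary:
  assumes "\<And>i. odd (m div 2 ^ i) \<longleftrightarrow> odd (n div 2 ^ i)" shows "m = (n :: nat)"
proof -
  have "set_decode m = set_decode n" using assms by (simp add: set_decode_def)
  then show ?thesis by (metis set_decode_inverse)
qed

lemma odd_div_power2_imp_less:
  assumes "odd (m div 2 ^ i)" "(m :: nat) < 2 ^ s" shows "i < s"
proof (rule ccontr)
  assume "\<not> i < s"
  then have "(2 :: nat) ^ s \<le> 2 ^ i" by (intro power_increasing) auto
  with assms(2) have "m < 2 ^ i" by (rule order_less_le_trans)
  then show False using assms(1) by simp
qed

lemma odd_mod_power2_div: "odd (m mod 2 ^ l div 2 ^ i) \<longleftrightarrow> i < l \<and> odd ((m :: nat) div 2 ^ i)"
  using bit_take_bit_iff[of l m i] by (simp add: bit_iff_odd take_bit_eq_mod)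

lemma prefix_code_mod:
  assumes "l \<le> s" shows "prefix_code s X mod 2 ^ l = prefix_code l X"
  by (rule nat_eqI_binary) (use assms in \<open>auto simp: odd_mod_power2_div odd_prefix_code_div\<close>)

lemma prefix_code_less: "prefix_code s X < 2 ^ s"
  using prefix_code_mod[of s s X] by (metis mod_less_divisor order_refl pos2 zero_less_power)

lemma prefix_code_eq_iff:
  assumes "m < 2 ^ s"
  shows "prefix_code s X = m \<longleftrightarrow> (\<forall>i<s. X i = odd (m div 2 ^ i))"
proof
  assume "prefix_code s X = m"
  then show "\<forall>i<s. X i = odd (m div 2 ^ i)" using odd_prefix_code_div[of s X] by auto
next
  assume "\<forall>i<s. X i = odd (m div 2 ^ i)"
  then show "prefix_code s X = m"
    using odd_div_power2_imp_less[OF _ assms]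
    by (intro nat_eqI_binary) (auto simp: odd_prefix_code_div)
qed

lemma prod_emb_UNIV_eq:
  "prod_emb UNIV (\<lambda>_. measure_pmf M) J (PiE J (\<lambda>i. {g i})) = {X. \<forall>i\<in>J. X i = g i}"
  by (auto simp: prod_emb_def PiE_iff)

lemma cylinder_coin_flips:
  assumes "m < 2 ^ s"
  shows sets_cylinder: "{X. prefix_code s X = m} \<in> sets coin_flips"
    and measure_cylinder: "measure coin_flips {X. prefix_code s X = m} = 1 / 2 ^ s"
proof -
  let ?M = "\<lambda>_ :: nat. measure_pmf (bernoulli_pmf (1 / 2))"
  have eq: "{X. prefix_code s X = m} = prod_emb UNIV ?M {..<s} (PiE {..<s} (\<lambda>i. {odd (m div 2 ^ i)}))"
  proof -
    have "{X. \<forall>i<s. X i = g i} = prod_emb UNIV ?M {..<s} (PiE {..<s} (\<lambda>i. {g i}))" for g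
      unfolding prod_emb_UNIV_eq by auto
    then show ?thesis unfolding prefix_code_eq_iff[OF assms] .
  qed
  show "{X. prefix_code s X = m} \<in> sets coin_flips"
    unfolding eq by (intro sets_PiM_I) auto
  have "measure coin_flips {X. prefix_code s X = m} =
      (\<Prod>i<s. measure (measure_pmf (bernoulli_pmf (1 / 2))) {odd (m div 2 ^ i)})"
    unfolding eq by (intro coin.measure_PiM_emb) auto
  also have "\<dots> = (\<Prod>i<s. 1 / 2)"
    by (intro prod.cong refl) (simp add: measure_pmf_single pmf_bernoulli_half)
  finally show "measure coin_flips {X. prefix_code s X = m} = 1 / 2 ^ s"
    by (simp add: power_one_over)
qed

text \<open>The event is a finite disjoint union of cylinders of equal measure. The numerator is a
  count that a program can evaluate, which makes comparisons of such measures decidable.\<close>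

lemma prefix_event_coin_flips:
  shows sets_prefix_event: "{X. P (prefix_code s X)} \<in> sets coin_flips"
    and measure_prefix_event:
      "measure coin_flips {X. P (prefix_code s X)} = real (\<Sum>m<2 ^ s. of_bool (P m)) / 2 ^ s"
proof -
  let ?I = "{m. m < 2 ^ s \<and> P m}"
  have eq: "{X. P (prefix_code s X)} = (\<Union>m\<in>?I. {X. prefix_code s X = m})"
    using prefix_code_less by auto
  show "{X. P (prefix_code s X)} \<in> sets coin_flips"
    unfolding eq by (intro sets.finite_UN) (auto intro: sets_cylinder)
  have "measure coin_flips {X. P (prefix_code s X)} =
      (\<Sum>m\<in>?I. measure coin_flips {X. prefix_code s X = m})"
    unfolding eq
    by (intro coin.finite_measure_finite_Union) (auto simp: disjoint_family_on_def intro: sets_cylinder)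
  also have "\<dots> = (\<Sum>m\<in>?I. 1 / 2 ^ s)"
    by (intro sum.cong) (auto simp: measure_cylinder)
  also have "{..<2 ^ s} \<inter> {m. P m} = ?I" by auto
  then have "(\<Sum>m\<in>?I. 1 / 2 ^ s) = real (\<Sum>m<2 ^ s. of_bool (P m)) / 2 ^ s"
    by (simp add: sum_of_bool_eq)
  finally show "measure coin_flips {X. P (prefix_code s X)} = real (\<Sum>m<2 ^ s. of_bool (P m)) / 2 ^ s" .
qed

text \<open>The sets with this property for some \<open>l\<close> are the clopen subsets of Cantor
  space.\<close>

definition determined_by_prefix :: "nat \<Rightarrow> (nat \<Rightarrow> bool) set \<Rightarrow> bool" where
  "determined_by_prefix l B \<longleftrightarrow> (\<forall>X Y. (\<forall>i<l. X i = Y i) \<longrightarrow> X \<in> B \<longrightarrow> Y \<in> B)"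

lemma determined_by_prefix_code:
  assumes "determined_by_prefix l B"
  shows "B = {X. prefix_code l X \<in> prefix_code l ` B}"
proof -
  have "X \<in> B" if "prefix_code l X = prefix_code l Y" "Y \<in> B" for X Y
  proof -
    have "\<forall>i<l. Y i = X i" using odd_prefix_code_div[of l] that(1) by metis
    then show ?thesis using assms that(2) unfolding determined_by_prefix_def by blast
  qed
  then show ?thesis by auto
qed

lemma determined_by_prefix_sets:
  assumes "determined_by_prefix l B" shows "B \<in> sets coin_flips"
proof -
  have "{X. prefix_code l X \<in> prefix_code l ` B} \<in> sets coin_flips" by (rule sets_prefix_event)
  then show ?thesis using determined_by_prefix_code[OF assms] by (rule ssubst[rotated])
qed

lemma determined_by_prefix_mono: "determined_by_prefix l B \<Longrightarrow> l \<le> l' \<Longrightarrow> determined_by_prefix l' B"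
  unfolding determined_by_prefix_def by (auto dest: order_less_le_trans)

text \<open>Induction over the generated sigma-algebra: the subbasic sets are clopen, complements
  keep the symmetric difference, and countable unions are first cut to finite ones.\<close>

lemma approx_by_prefix_event:
  assumes "A \<in> sets coin_flips" "0 < \<epsilon>"
  shows "\<exists>B l. determined_by_prefix l B \<and> measure coin_flips ((A - B) \<union> (B - A)) < \<epsilon>"
proof -
  have "sets coin_flips = sigma_sets UNIV {{f. f i \<in> A} | i A. True}"
    by (simp add: sets_PiM_single)
  with assms(1) have "A \<in> sigma_sets UNIV {{f :: nat \<Rightarrow> bool. f i \<in> A} | i A. True}" by simp
  then show ?thesis using assms(2)
  proof (induction arbitrary: \<epsilon>)
    case (Basic A)
    then obtain i S where "A = {f. f i \<in> S}" by blast
    then have "determined_by_prefix (Suc i) A" by (auto simp: determined_by_prefix_def)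
    then show ?case using Basic.prems by (intro exI[of _ A] exI[of _ "Suc i"]) simp
  next
    case Empty
    then show ?case by (intro exI[of _ "{}"] exI[of _ 0]) (simp add: determined_by_prefix_def)
  next
    case (Compl A)
    from Compl.IH[OF Compl.prems] obtain B l
      where B: "determined_by_prefix l B" "measure coin_flips ((A - B) \<union> (B - A)) < \<epsilon>" by blast
    have "determined_by_prefix l (- B)"
      using B(1) unfolding determined_by_prefix_def by (metis ComplD ComplI)
    moreover have "(UNIV - A - - B) \<union> (- B - (UNIV - A)) = (A - B) \<union> (B - A)" by auto
    ultimately show ?case using B(2) by metis
  next
    case (Union A)
    have A: "A i \<in> sets coin_flips" for i
      using Union.hyps by (simp add: sets_PiM_single)
    let ?F = "\<lambda>n. \<Union>i<n. A i"
    have "(\<lambda>n. measure coin_flips (?F n)) \<longlonglongrightarrow> measure coin_flips (\<Union>n. ?F n)"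
      using A by (intro coin.finite_Lim_measure_incseq) (auto simp: incseq_def intro: order_less_le_trans)
    moreover have U: "(\<Union>n. ?F n) = (\<Union>i. A i)" by blast
    ultimately have "\<forall>\<^sub>F n in sequentially. measure coin_flips (\<Union>i. A i) - \<epsilon> / 2 < measure coin_flips (?F n)"
      using Union.prems by (intro order_tendstoD(1)[where y = "measure coin_flips (\<Union>i. A i)"]) auto
    then obtain n where n: "measure coin_flips (\<Union>i. A i) - \<epsilon> / 2 < measure coin_flips (?F n)"
      by (auto simp: eventually_sequentially)
    \<comment> \<open>Half of the error pays for truncating the union, the other half is shared
      among the \<open>n\<close> sets. \<open>Suc n\<close> keeps the denominator positive.\<close>
    have "\<forall>i. \<exists>B l. determined_by_prefix l B \<and>
        measure coin_flips ((A i - B) \<union> (B - A i)) < \<epsilon> / (2 * Suc n)"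
      using Union.IH Union.prems by simp
    then obtain B l where B: "\<And>i. determined_by_prefix (l i) (B i)"
      "\<And>i. measure coin_flips ((A i - B i) \<union> (B i - A i)) < \<epsilon> / (2 * Suc n)"
      by metis
    let ?B = "\<Union>i<n. B i" and ?D = "\<lambda>i. (A i - B i) \<union> (B i - A i)"
    have Bs: "B i \<in> sets coin_flips" for i by (rule determined_by_prefix_sets) (rule B)
    \<comment> \<open>The sum of the lengths serves as a common upper bound.\<close>
    have "l i \<le> (\<Sum>i<n. l i)" if "i < n" for i
      using that by (intro member_le_sum) auto
    then have "determined_by_prefix (\<Sum>i<n. l i) (B i)" if "i < n" for i
      using determined_by_prefix_mono[OF B(1)] that by blast
    then have "determined_by_prefix (\<Sum>i<n. l i) ?B"
      unfolding determined_by_prefix_def by (metis (no_types, lifting) UN_iff lessThan_iff)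
    moreover have "measure coin_flips (((\<Union>i. A i) - ?B) \<union> (?B - (\<Union>i. A i))) < \<epsilon>"
    proof -
      have "measure coin_flips (((\<Union>i. A i) - ?B) \<union> (?B - (\<Union>i. A i))) \<le>
          measure coin_flips (((\<Union>i. A i) - ?F n) \<union> (\<Union>i<n. ?D i))"
        using A Bs by (intro coin.finite_measure_mono) auto
      also have "\<dots> \<le> measure coin_flips ((\<Union>i. A i) - ?F n) + measure coin_flips (\<Union>i<n. ?D i)"
        using A Bs by (intro measure_Un_le) auto
      also have "measure coin_flips ((\<Union>i. A i) - ?F n) < \<epsilon> / 2"
        using A n by (subst coin.finite_measure_Diff) auto
      also have "measure coin_flips (\<Union>i<n. ?D i) \<le> (\<Sum>i<n. measure coin_flips (?D i))"
        using A Bs by (intro coin.finite_measure_subadditive_finite) auto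
      also have "\<dots> \<le> (\<Sum>i<n. \<epsilon> / (2 * Suc n))"
        using B(2) by (intro sum_mono less_imp_le)
      also have "\<dots> \<le> \<epsilon> / 2"
        using Union.prems by (simp add: field_simps)
      finally show ?thesis by simp
    qed
    ultimately show ?case by blast
  qed
qed

section \<open>Majority vote\<close>

text \<open>The number of missing elements below \<open>n\<close> is compared with
  \<open>n / Suc e\<close> after clearing denominators. This leaves only natural number arithmetic,
  as the matrix of a \<Pi>4 class demands.\<close>

lemma has_density_1_iff:
  "has_density A 1 \<longleftrightarrow> (\<forall>e. \<exists>N. \<forall>n\<ge>N. Suc e * (n - card (A \<inter> {0..<n})) \<le> n)"
proof -
  define a where "a n = card (A \<inter> {0..<n})" for n
  have a: "a n \<le> n" for n
    unfolding a_def by (metis card_mono card_atLeastLessThan diff_zero finite_atLeastLessThan inf_le2)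
  have key: "Suc e * (n - a n) \<le> n \<longleftrightarrow> 1 - rho_upto n A \<le> 1 / Suc e" if "0 < n" for e n
  proof -
    have "Suc e * (n - a n) \<le> n \<longleftrightarrow> real (Suc e * (n - a n)) \<le> real n" by (simp only: of_nat_le_iff)
    also have "\<dots> \<longleftrightarrow> real (Suc e) * (real n - real (a n)) \<le> real n"
      by (simp only: of_nat_mult of_nat_diff[OF a])
    also have "\<dots> \<longleftrightarrow> 1 - rho_upto n A \<le> 1 / Suc e"
      unfolding rho_upto_def a_def[symmetric] using that by (simp add: field_simps)
    finally show ?thesis .
  qed
  have le1: "rho_upto n A \<le> 1" for n
    unfolding rho_upto_def a_def[symmetric] using a[of n] by (simp add: divide_le_eq)
  show ?thesis unfolding a_def[symmetric]
  proof
    assume A: "has_density A 1"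
    show "\<forall>e. \<exists>N. \<forall>n\<ge>N. Suc e * (n - a n) \<le> n"
    proof
      fix e
      have "\<forall>\<^sub>F n in sequentially. 1 - 1 / Suc e < rho_upto n A"
        using A unfolding has_density_def by (rule order_tendstoD) simp
      then obtain N where N: "\<forall>n\<ge>N. 1 - 1 / Suc e < rho_upto n A"
        unfolding eventually_sequentially by blast
      have "Suc e * (n - a n) \<le> n" if "n \<ge> N" for n
      proof (cases "n = 0")
        case False
        then show ?thesis using N that by (subst key) (auto simp: algebra_simps intro: less_imp_le)
      qed simp
      then show "\<exists>N. \<forall>n\<ge>N. Suc e * (n - a n) \<le> n" by blast
    qed
  next
    assume A: "\<forall>e. \<exists>N. \<forall>n\<ge>N. Suc e * (n - a n) \<le> n"
    show "has_density A 1" unfolding has_density_def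
    proof (rule LIMSEQ_I)
      fix r :: real assume "0 < r"
      then obtain e where e: "1 / Suc e < r" using nat_approx_posE by blast
      obtain N where N: "\<forall>n\<ge>N. Suc e * (n - a n) \<le> n" using A by blast
      \<comment> \<open>Starting at \<open>Suc N\<close> makes \<open>n\<close> positive, as
        \<open>key\<close> requires.\<close>
      have "norm (rho_upto n A - 1) < r" if "n \<ge> Suc N" for n
        using N key[of n e] that e le1[of n] by auto
      then show "\<exists>no. \<forall>n\<ge>no. norm (rho_upto n A - 1) < r" by blast
    qed
  qed
qed

lemma has_density_1_mono:
  assumes "has_density A 1" "A \<subseteq> B" shows "has_density B 1"
proof -
  have "card (A \<inter> {0..<n}) \<le> card (B \<inter> {0..<n})" for n
    using assms(2) by (intro card_mono) auto
  then show ?thesis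
    using assms(1) unfolding has_density_1_iff
    by (meson diff_le_mono2 mult_le_mono2 order_trans)
qed

section \<open>Arithmetical complexity and measurability of the class of a code\<close>

definition computes_densely :: "recf \<Rightarrow> (nat \<Rightarrow> nat) \<Rightarrow> (nat \<Rightarrow> bool) set" where
  "computes_densely c f = {X. dense_description (\<lambda>n. run (char_fun X) c [n]) f}"

lemma densely_computable_in_iff: "densely_computable_in X f \<longleftrightarrow> (\<exists>c. X \<in> computes_densely c f)"
proof -
  have "(\<forall>n. run (char_fun X) c [n] = d n) \<longleftrightarrow> d = (\<lambda>n. run (char_fun X) c [n])" for c d
    by auto
  then show ?thesis
    unfolding densely_computable_in_def partial_computable_in_def computes_densely_def by auto
qed

definition agreement :: "recf \<Rightarrow> (nat \<Rightarrow> nat) \<Rightarrow> (nat \<Rightarrow> nat) \<Rightarrow> nat \<Rightarrow> nat \<Rightarrow> nat" where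
  "agreement c f Z n s = (\<Sum>k<n. of_bool (srun Z s c [k] = Suc (f k)))"

text \<open>Soundness bounds \<open>agreement\<close> by the true number of correct values, and some
  stage reveals all correct values below \<open>n\<close>. The guard \<open>n < N\<close> stands
  inside the matrix to obtain prenex form.\<close>

lemma computes_densely_iff:
  "X \<in> computes_densely c f \<longleftrightarrow>
     (\<forall>e. \<exists>N. \<forall>n. \<exists>s. n < N \<or> Suc e * (n - agreement c f (char_fun X) n s) \<le> n)"
proof -
  let ?Z = "char_fun X"
  let ?A = "{k. run ?Z c [k] = Some (f k)}"
  have agr: "agreement c f ?Z n s = card {k. k < n \<and> srun ?Z s c [k] = Suc (f k)}" for n s
  proof -
    have "{..<n} \<inter> {k. srun ?Z s c [k] = Suc (f k)} = {k. k < n \<and> srun ?Z s c [k] = Suc (f k)}" by auto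
    then show ?thesis by (simp add: agreement_def sum_of_bool_eq)
  qed
  have le: "agreement c f ?Z n s \<le> card (?A \<inter> {0..<n})" for n s
    unfolding agr by (intro card_mono) (auto dest: srun_sound)
  have "\<exists>s. agreement c f ?Z n s = card (?A \<inter> {0..<n})" for n
  proof -
    have "\<forall>\<^sub>F s in sequentially. \<forall>k\<in>?A \<inter> {0..<n}. srun ?Z s c [k] = Suc (f k)"
      by (intro eventually_ball_finite) (auto intro: srun_complete)
    then obtain s where "\<forall>k\<in>?A \<inter> {0..<n}. srun ?Z s c [k] = Suc (f k)"
      by (auto simp: eventually_sequentially)
    then have "{k. k < n \<and> srun ?Z s c [k] = Suc (f k)} = ?A \<inter> {0..<n}"
      by (auto dest: srun_sound)
    then have "agreement c f ?Z n s = card (?A \<inter> {0..<n})" by (simp only: agr)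
    then show ?thesis ..
  qed
  then have "(\<exists>s. Suc e * (n - agreement c f ?Z n s) \<le> n) \<longleftrightarrow> Suc e * (n - card (?A \<inter> {0..<n})) \<le> n" for n e
    using le by (metis diff_le_mono2 mult_le_mono2 order_trans)
  then show ?thesis
    unfolding computes_densely_def dense_description_def has_density_1_iff mem_Collect_eq ex_disj_distrib
    by (meson not_le)
qed

lemma ucomp_srun1:
  assumes "ucomp b 2 (\<lambda>Z e. Q Z (e 0) (e 1))"
  shows "ucomp b 3 (\<lambda>Z e. srun (Q Z (e 1)) (e 0) c [e 2])"
  using ucomp_srun[OF assms, of 1 c] by (simp add: eval_nat_numeral)

lemma pi_class_computes_densely: "pi_class 4 f (computes_densely c f)"
proof -
  have "ucomp True 2 (\<lambda>Z e. Z (2 * e 1))"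
    by (intro ucomp_query ucomp_intros) auto
  then have sr: "ucomp True 3 (\<lambda>Z e. srun (\<lambda>x. Z (2 * x)) (e 0) c [e 2])"
    by (rule ucomp_srun1[where Q = "\<lambda>Z p x. Z (2 * x)"])
  \<comment> \<open>The variables play the roles of \<open>e\<close>, \<open>N\<close>,
    \<open>n\<close> and the stage. Even positions of the joined oracle carry \<open>X\<close>, odd
    ones carry \<open>f\<close>.\<close>
  let ?R = "\<lambda>Z x y z s. z < y \<or>
     Suc x * (z - (\<Sum>k<z. of_bool (srun (\<lambda>x. Z (2 * x)) s c [k] = Suc (Z (Suc (2 * k)))))) \<le> z"
  have sr': "ucomp True 5 (\<lambda>Z e. srun (\<lambda>x. Z (2 * x)) (e (Suc 3)) c [e 0])"
    by (rule ucomp_comp3[OF sr, where F = "\<lambda>Z e. e (Suc 3)" and G = "\<lambda>Z e. e 0" and H = "\<lambda>Z e. e 0"])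
       (auto intro: ucomp_var)
  have "ucomp True 4 (\<lambda>Z e. of_bool (?R Z (e 0) (e 1) (e 2) (e 3)))"
    apply (rule ucomp_disj)
     apply (intro ucomp_less ucomp_var; simp)
    apply (rule ucomp_le)
     apply (rule ucomp_mult)
      apply (intro ucomp_Suc ucomp_var; simp)
     apply (rule ucomp_minus)
      apply (rule ucomp_var, simp)
     apply (rule ucomp_sum)
      apply (rule ucomp_var, simp)
     apply (rule ucomp_eq)
      apply (use sr' in \<open>simp add: eval_nat_numeral\<close>)
     apply (intro ucomp_Suc ucomp_query ucomp_mult ucomp_const ucomp_var; simp)
    apply (rule ucomp_var, simp)
    done
  then obtain r where r: "\<And>Z e. run Z r (map e [0..<4]) = Some (of_bool (?R Z (e 0) (e 1) (e 2) (e 3)))"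
    unfolding ucomp_def by blast
  have upt4: "[0..<4] = [0, 1, 2, 3]" by (simp add: upt_rec)
  have r4: "run Z r [x, y, z, s] = Some (of_bool (?R Z x y z s))" for Z x y z s
    using r[of Z "\<lambda>i. [x, y, z, s] ! i"] by (simp add: upt4 numeral_3_eq_3 numeral_2_eq_2)
  have join: "oracle_join Y f (2 * x) = Y x" "oracle_join Y f (Suc (2 * x)) = f x" for Y x
    by (simp_all add: oracle_join_def)
  have rj: "run (oracle_join (char_fun X) f) r [x, y, z, s] =
      Some (of_bool (z < y \<or> Suc x * (z - agreement c f (char_fun X) z s) \<le> z))" for X x y z s
    unfolding r4 join agreement_def ..
  have "run (oracle_join (char_fun X) f) r xs \<in> {Some 0, Some 1}" if len: "length xs = 4" for X xs
  proof -
    obtain x y z s where "xs = [x, y, z, s]"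
      using len by (auto simp: length_Suc_conv eval_nat_numeral)
    then show ?thesis by (simp add: rj del: mult_Suc)
  qed
  moreover have "computes_densely c f =
      {X. pi_prefix 4 (\<lambda>xs. run (oracle_join (char_fun X) f) r xs = Some 1)}"
  proof -
    have pi: "pi_prefix 4 R \<longleftrightarrow> (\<forall>x. \<exists>y. \<forall>z. \<exists>s. R [x, y, z, s])" for R
      by (simp add: eval_nat_numeral)
    have one: "Some (of_bool p :: nat) = Some 1 \<longleftrightarrow> p" for p by simp
    show ?thesis
      by (rule set_eqI) (simp only: computes_densely_iff mem_Collect_eq pi rj one)
  qed
  ultimately show ?thesis unfolding pi_class_def by blast
qed

lemma determined_by_prefix_srun:
  "determined_by_prefix s {X. P (\<lambda>xs. srun (char_fun X) s c xs)}"
proof -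
  have "srun (char_fun X) s c = srun (char_fun Y) s c" if "\<forall>i<s. X i = Y i" for X Y
    using that by (intro ext srun_cong) (simp add: char_fun_def)
  then show ?thesis unfolding determined_by_prefix_def by (metis (no_types, lifting) ext mem_Collect_eq)
qed

lemmas sets_srun = determined_by_prefix_sets[OF determined_by_prefix_srun]

text \<open>The four number quantifiers become countable intersections and unions of clopen
  sets.\<close>

lemma sets_computes_densely: "computes_densely c f \<in> sets coin_flips"
proof -
  have *: "{X. n < N \<or> Suc e * (n - agreement c f (char_fun X) n s) \<le> n} \<in> sets coin_flips" for e N n s
    unfolding agreement_def
    by (rule sets_srun[of "\<lambda>g. n < N \<or> Suc e * (n - (\<Sum>k<n. of_bool (g [k] = Suc (f k)))) \<le> n" s c])
  have "computes_densely c f =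
      (\<Inter>e. \<Union>N. \<Inter>n. \<Union>s. {X. n < N \<or> Suc e * (n - agreement c f (char_fun X) n s) \<le> n})"
    by (auto simp: computes_densely_iff simp del: mult_Suc)
  also have "\<dots> \<in> sets coin_flips"
    by (intro sets.countable_INT sets.countable_UN image_subsetI * ) auto
  finally show ?thesis .
qed

lemma sets_run: "{X. run (char_fun X) c [k] = Some v} \<in> sets coin_flips"
proof -
  have "{X. run (char_fun X) c [k] = Some v} = (\<Union>s. {X. srun (char_fun X) s c [k] = Suc v})"
    using srun_sound srun_complete by (fastforce simp: eventually_sequentially)
  also have "\<dots> \<in> sets coin_flips"
    by (intro sets.countable_UN image_subsetI sets_srun[of "\<lambda>g. g [k] = Suc v" _ c])
  finally show ?thesis .
qed

text \<open>
  If \<open>c\<close> computes \<open>f\<close> densely from every \<open>X \<in> E\<close>, then by dominated convergence the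
  average over \<open>k < n\<close> of the measure of \<open>{X \<in> E. c computes f k}\<close> tends to \<open>\<mu> E\<close>. As no term
  exceeds \<open>\<mu> E\<close>, Markov's inequality shows that almost all terms are close to \<open>\<mu> E\<close>.
\<close>

lemma density_majority:
  assumes E: "E \<in> sets coin_flips" "E \<subseteq> computes_densely c f" and r: "r < measure coin_flips E"
  shows "has_density {k. r < measure coin_flips (E \<inter> {X. run (char_fun X) c [k] = Some (f k)})} 1"
proof -
  let ?\<mu> = "measure coin_flips"
  define S where "S k = {X. run (char_fun X) c [k] = Some (f k)}" for k
  define q where "q k = ?\<mu> (E \<inter> S k)" for k
  define \<delta> where "\<delta> = ?\<mu> E - r"
  have \<delta>: "\<delta> > 0" using r by (simp add: \<delta>_def)
  have S [measurable]: "S k \<in> sets coin_flips" for k unfolding S_def by (rule sets_run)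
  note [measurable] = E(1)
  define g where "g n X = (\<Sum>k<n. indicator (E \<inter> S k) X) / real n" for n X
  have g_rho: "g n X = indicator E X * rho_upto n {k. X \<in> S k}" for n X
  proof -
    have "{k. X \<in> S k} \<inter> {0..<n} = {k \<in> {..<n}. X \<in> S k}" by auto
    then have "real (card ({k. X \<in> S k} \<inter> {0..<n})) = (\<Sum>k<n. indicator (S k) X)"
      by (simp add: indicator_def sum.If_cases Int_def)
    then show ?thesis
      by (simp add: g_def rho_upto_def indicator_inter_arith sum_distrib_left)
  qed
  have "(\<lambda>n. \<integral>X. g n X \<partial>coin_flips) \<longlonglongrightarrow> (\<integral>X. indicator E X \<partial>coin_flips)"
  proof (rule integral_dominated_convergence[where w = "\<lambda>_. 1"])
    show "AE X in coin_flips. (\<lambda>n. g n X) \<longlonglongrightarrow> indicator E X"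
    proof (rule AE_I2)
      fix X
      show "(\<lambda>n. g n X) \<longlonglongrightarrow> indicator E X"
      proof (cases "X \<in> E")
        case True
        then have "(\<lambda>n. rho_upto n {k. X \<in> S k}) \<longlonglongrightarrow> 1"
          using E(2) by (auto simp: computes_densely_def dense_description_def has_density_def S_def)
        then show ?thesis using True by (simp add: g_rho)
      qed (simp add: g_rho)
    qed
    show "AE X in coin_flips. norm (g n X) \<le> 1" for n
    proof (rule AE_I2)
      fix X
      have "card ({k. X \<in> S k} \<inter> {0..<n}) \<le> n"
        by (metis card_mono card_atLeastLessThan diff_zero finite_atLeastLessThan inf_le2)
      then show "norm (g n X) \<le> 1"
        by (auto simp: g_rho rho_upto_def indicator_def divide_le_eq)
    qed
  qed (auto simp: g_def)
  moreover have "(\<integral>X. g n X \<partial>coin_flips) = (\<Sum>k<n. q k) / real n" for n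
  proof -
    have "(\<integral>X. (\<Sum>k<n. indicator (E \<inter> S k) X) \<partial>coin_flips) =
        (\<Sum>k<n. (\<integral>X. indicator (E \<inter> S k) X \<partial>coin_flips) :: real)"
      by (intro Bochner_Integration.integral_sum) (simp add: coin.emeasure_eq_measure)
    then show ?thesis by (simp add: g_def q_def)
  qed
  ultimately have lim: "(\<lambda>n. (\<Sum>k<n. q k) / real n) \<longlonglongrightarrow> ?\<mu> E" by simp
  define G where "G = {k. r < q k}"
  have bound: "1 - (?\<mu> E - (\<Sum>k<n. q k) / real n) / \<delta> \<le> rho_upto n G" if "n > 0" for n
  proof -
    have qE: "q k \<le> ?\<mu> E" for k
      unfolding q_def by (intro coin.finite_measure_mono) auto
    \<comment> \<open>The Markov step: each \<open>k\<close> outside \<open>G\<close> falls short of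
      the measure of \<open>E\<close> by at least \<open>\<delta>\<close>, and no \<open>k\<close>
      exceeds it.\<close>
    have "(\<Sum>k<n. \<delta> * (1 - of_bool (k \<in> G))) \<le> (\<Sum>k<n. ?\<mu> E - q k)"
      using qE by (intro sum_mono) (auto simp: G_def \<delta>_def)
    moreover have "{..<n} \<inter> {k. k \<in> G} = G \<inter> {0..<n}" by auto
    then have "(\<Sum>k<n. \<delta> * (1 - of_bool (k \<in> G))) = \<delta> * (n - real (card (G \<inter> {0..<n})))"
      unfolding sum_distrib_left[symmetric] by (simp add: sum_subtractf sum_of_bool_eq)
    ultimately have "\<delta> * (n - real (card (G \<inter> {0..<n}))) \<le> n * ?\<mu> E - (\<Sum>k<n. q k)"
      by (simp add: sum_subtractf)
    then have "real n * (\<delta> * (1 - rho_upto n G)) \<le> real n * (?\<mu> E - (\<Sum>k<n. q k) / real n)"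
      using that by (simp add: rho_upto_def right_diff_distrib mult.commute)
    then have "\<delta> * (1 - rho_upto n G) \<le> ?\<mu> E - (\<Sum>k<n. q k) / real n"
      using that by simp
    then have "1 - rho_upto n G \<le> (?\<mu> E - (\<Sum>k<n. q k) / real n) / \<delta>"
      using \<delta> by (simp add: pos_le_divide_eq mult.commute)
    then show ?thesis by simp
  qed
  have "has_density G 1" unfolding has_density_def
  proof (rule tendsto_sandwich)
    show "\<forall>\<^sub>F n in sequentially. 1 - (?\<mu> E - (\<Sum>k<n. q k) / real n) / \<delta> \<le> rho_upto n G"
      using eventually_gt_at_top[of 0] by eventually_elim (rule bound)
    show "\<forall>\<^sub>F n in sequentially. rho_upto n G \<le> 1"
    proof (rule always_eventually, rule allI)
      fix n
      have "card (G \<inter> {0..<n}) \<le> n"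
        by (metis card_mono card_atLeastLessThan diff_zero finite_atLeastLessThan inf_le2)
      then show "rho_upto n G \<le> 1" by (simp add: rho_upto_def divide_le_eq)
    qed
    show "(\<lambda>n. 1 - (?\<mu> E - (\<Sum>k<n. q k) / real n) / \<delta>) \<longlonglongrightarrow> 1"
      using tendsto_diff[OF tendsto_const[of 1] tendsto_divide[OF tendsto_diff[OF tendsto_const[of "?\<mu> E"] lim]
            tendsto_const[of \<delta>]]] \<delta> by simp
  qed simp
  then show ?thesis by (simp add: G_def q_def S_def)
qed

text \<open>
  Counts the strings of length \<open>s\<close>, coded as numbers, that lie in the clopen set whose prefixes of
  length \<open>l\<close> form the finite set with canonical index \<open>K\<close>, and on which \<open>c\<close> maps \<open>n\<close> to \<open>m\<close>.
\<close>

definition majority_weight :: "recf \<Rightarrow> nat \<Rightarrow> nat \<Rightarrow> nat \<Rightarrow> nat \<Rightarrow> nat \<Rightarrow> nat" where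
  "majority_weight c l K s m n = (\<Sum>\<sigma><2 ^ s.
     of_bool (odd (K div 2 ^ (\<sigma> mod 2 ^ l)) \<and> srun (\<lambda>x. \<sigma> div 2 ^ x mod 2) s c [n] = Suc m))"

text \<open>Computations bounded by \<open>s\<close> see only the first \<open>s\<close> bits, so
  \<open>X\<close> may be replaced by its prefix. Truncation to length \<open>l\<close> is reduction
  modulo \<open>2 ^ l\<close>, for which \<open>l \<le> s\<close>.\<close>

lemma measure_majority_weight:
  assumes "l \<le> s"
  shows "measure coin_flips ({X. odd (K div 2 ^ prefix_code l X)} \<inter> {X. srun (char_fun X) s c [n] = Suc m}) =
    majority_weight c l K s m n / 2 ^ s"
proof -
  have "srun (\<lambda>x. prefix_code s X div 2 ^ x mod 2) s c [n] = srun (char_fun X) s c [n]" for X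
    by (rule srun_cong) (simp add: mod_2_eq_odd odd_prefix_code_div char_fun_def)
  then have "{X. odd (K div 2 ^ prefix_code l X)} \<inter> {X. srun (char_fun X) s c [n] = Suc m} =
    {X. odd (K div 2 ^ (prefix_code s X mod 2 ^ l)) \<and>
        srun (\<lambda>x. prefix_code s X div 2 ^ x mod 2) s c [n] = Suc m}"
    using assms by (auto simp: prefix_code_mod)
  then show ?thesis
    unfolding majority_weight_def
    by (simp only: measure_prefix_event[of "\<lambda>\<sigma>. odd (K div 2 ^ (\<sigma> mod 2 ^ l)) \<and>
          srun (\<lambda>x. \<sigma> div 2 ^ x mod 2) s c [n] = Suc m" s])
qed

lemma ucomp_majority_weight:
  assumes "ucomp b a S" "ucomp b a M" "ucomp b a N"
  shows "ucomp b a (\<lambda>Z e. majority_weight c l K (S Z e) (M Z e) (N Z e))"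
proof -
  \<comment> \<open>The simulated oracle extracts binary digits of the string passed as a parameter,
    so the real oracle is never consulted.\<close>
  have "ucomp b 2 (\<lambda>Z e. e 0 div 2 ^ e 1 mod 2)"
    by (intro ucomp_intros) auto
  then have "ucomp b 3 (\<lambda>Z e. srun (\<lambda>x. e 1 div 2 ^ x mod 2) (e 0) c [e 2])"
    by (rule ucomp_srun1[where Q = "\<lambda>Z p x. p div 2 ^ x mod 2"])
  then have sr: "ucomp b 4 (\<lambda>Z e. srun (\<lambda>x. e 0 div 2 ^ x mod 2) (e 1) c [e 3])"
    by (rule ucomp_comp3[where F = "\<lambda>Z e. e 1" and G = "\<lambda>Z e. e 0" and H = "\<lambda>Z e. e 3"])
       (auto intro: ucomp_var)
  have "ucomp b 3 (\<lambda>Z e. majority_weight c l K (e 0) (e 1) (e 2))"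
    unfolding majority_weight_def
    apply (rule ucomp_sum)
     apply (intro ucomp_power ucomp_const ucomp_var; simp)
    apply (rule ucomp_conj)
     apply (intro ucomp_odd ucomp_div ucomp_mod ucomp_power ucomp_const ucomp_var; simp)
    apply (rule ucomp_eq)
     apply (use sr in \<open>simp add: eval_nat_numeral\<close>)
    apply (intro ucomp_Suc ucomp_var; simp)
    done
  then show ?thesis using assms by (rule ucomp_comp3)
qed

lemma densely_computable_if_positive_measure:
  assumes pos: "0 < measure coin_flips (computes_densely c f)"
  shows "densely_computable f"
proof -
  let ?\<mu> = "measure coin_flips"
  define C where "C = computes_densely c f"
  have C [measurable]: "C \<in> sets coin_flips" unfolding C_def by (rule sets_computes_densely)
  \<comment> \<open>With this error, more than three quarters of \<open>C\<close> lies in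
    \<open>B\<close>, while \<open>B - C\<close> measures less than a quarter of \<open>C\<close>;
    hence \<open>C\<close> fills more than half of \<open>B\<close>.\<close>
  have "0 < ?\<mu> C / 4" using pos by (simp add: C_def)
  from approx_by_prefix_event[OF C this] obtain B l
    where B: "determined_by_prefix l B" "?\<mu> ((C - B) \<union> (B - C)) < ?\<mu> C / 4" by blast
  have [measurable]: "B \<in> sets coin_flips" using B(1) by (rule determined_by_prefix_sets)
  \<comment> \<open>The finitely many strings that determine \<open>B\<close> are wired into the
    program as one number.\<close>
  define K where "K = set_encode (prefix_code l ` B)"
  have "prefix_code l ` B \<subseteq> {..<2 ^ l}" using prefix_code_less by auto
  then have "set_decode K = prefix_code l ` B"
    unfolding K_def by (intro set_encode_inverse) (rule finite_subset, auto)
  then have BK: "B = {X. odd (K div 2 ^ prefix_code l X)}"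
    using determined_by_prefix_code[OF B(1)] by (auto simp: set_decode_def)
  have majority: "?\<mu> B / 2 < ?\<mu> (C \<inter> B)"
  proof -
    have "?\<mu> C = ?\<mu> (C \<inter> B) + ?\<mu> (C - B)"
      by (subst coin.finite_measure_Union[symmetric]) (auto intro: arg_cong[where f = ?\<mu>])
    moreover have "?\<mu> B = ?\<mu> (C \<inter> B) + ?\<mu> (B - C)"
      by (subst coin.finite_measure_Union[symmetric]) (auto intro: arg_cong[where f = ?\<mu>])
    moreover have "?\<mu> ((C - B) \<union> (B - C)) = ?\<mu> (C - B) + ?\<mu> (B - C)"
      by (intro coin.finite_measure_Union) auto
    moreover have "0 \<le> ?\<mu> (C - B)" "0 \<le> ?\<mu> (B - C)" by simp_all
    ultimately show ?thesis using B(2) pos by (simp add: C_def[symmetric])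
  qed
  define T where "T s k m = {X. srun (char_fun X) s c [k] = Suc m}" for s k m
  define S where "S k m = {X. run (char_fun X) c [k] = Some m}" for k m
  have [measurable]: "T s k m \<in> sets coin_flips" for s k m
    unfolding T_def by (rule sets_srun[of "\<lambda>g. g [k] = Suc m" s c])
  have [measurable]: "S k m \<in> sets coin_flips" for k m
    unfolding S_def by (rule sets_run)
  have TS: "T s k m \<subseteq> S k m" for s k m by (auto simp: T_def S_def dest: srun_sound)
  define b where "b = (\<Sum>\<sigma><2 ^ l. of_bool (odd (K div 2 ^ \<sigma>)) :: nat)"
  have \<mu>B: "?\<mu> B = b / 2 ^ l"
    unfolding BK b_def by (rule measure_prefix_event[of "\<lambda>\<sigma>. odd (K div 2 ^ \<sigma>)"])
  \<comment> \<open>The majority condition with denominators cleared. The stage is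
    \<open>t + l\<close>, so that strings are long enough to decide membership in
    \<open>B\<close>.\<close>
  let ?P = "\<lambda>t m k. b * 2 ^ (t + l) < 2 * 2 ^ l * majority_weight c l K (t + l) m k"
  have P_iff: "?P t m k \<longleftrightarrow> ?\<mu> B / 2 < ?\<mu> (B \<inter> T (t + l) k m)" for t m k
  proof -
    have "?\<mu> (B \<inter> T (t + l) k m) = majority_weight c l K (t + l) m k / 2 ^ (t + l)"
      unfolding BK T_def by (rule measure_majority_weight) simp
    then have "?\<mu> B / 2 < ?\<mu> (B \<inter> T (t + l) k m) \<longleftrightarrow>
        real b * 2 ^ (t + l) < 2 * 2 ^ l * real (majority_weight c l K (t + l) m k)"
      unfolding \<mu>B by (simp only:) (simp add: field_simps)
    also have "\<dots> \<longleftrightarrow> real (b * 2 ^ (t + l)) < real (2 * 2 ^ l * majority_weight c l K (t + l) m k)"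
      by simp
    also have "\<dots> \<longleftrightarrow> ?P t m k" by (simp only: of_nat_less_iff)
    finally show ?thesis by simp
  qed
  have "ucomp False 3 (\<lambda>Z e. of_bool (?P (e 0) (e 1) (e 2)))"
    by (intro ucomp_less ucomp_mult ucomp_power ucomp_plus ucomp_majority_weight ucomp_const ucomp_var) auto
  then obtain d where d: "False \<or> oracle_free d" and
    run_d: "\<And>Z n t m. \<lbrakk>m < t; ?P t m n; \<And>t' m'. m' < t' \<Longrightarrow> ?P t' m' n \<Longrightarrow> m' = m\<rbrakk>
      \<Longrightarrow> run Z d [n] = Some m"
    by (rule ucomp_search) blast
  have good: "run (\<lambda>_. 0) d [k] = Some (f k)" if k: "?\<mu> B / 2 < ?\<mu> (C \<inter> B \<inter> S k (f k))" for k
  proof -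
    have gt: "?\<mu> B / 2 < ?\<mu> (B \<inter> S k (f k))"
      using k by (rule order_less_le_trans) (intro coin.finite_measure_mono; auto)
    \<comment> \<open>Demanding the answer at all later stages makes this family increasing by
      construction, and continuity from below applies.\<close>
    define U where "U t = (\<Inter>s\<in>{t..}. T s k (f k))" for t
    have [measurable]: "U t \<in> sets coin_flips" for t
      unfolding U_def by (intro sets.countable_INT') auto
    have "(\<Union>t. B \<inter> U t) = B \<inter> S k (f k)"
    proof
      have "U t \<subseteq> T t k (f k)" for t by (auto simp: U_def)
      then show "(\<Union>t. B \<inter> U t) \<subseteq> B \<inter> S k (f k)" using TS by blast
      show "B \<inter> S k (f k) \<subseteq> (\<Union>t. B \<inter> U t)"
        using srun_complete by (fastforce simp: U_def S_def T_def eventually_sequentially)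
    qed
    moreover have "(\<lambda>t. ?\<mu> (B \<inter> U t)) \<longlonglongrightarrow> ?\<mu> (\<Union>t. B \<inter> U t)"
      by (intro coin.finite_Lim_measure_incseq) (auto simp: incseq_def U_def)
    ultimately have "\<forall>\<^sub>F t in sequentially. ?\<mu> B / 2 < ?\<mu> (B \<inter> U t)"
      using gt by (intro order_tendstoD(1)[where y = "?\<mu> (B \<inter> S k (f k))"]) auto
    \<comment> \<open>The search tests only values below the stage, hence the demand
      \<open>f k < t\<close>.\<close>
    from eventually_conj[OF this eventually_gt_at_top[of "f k"]]
    obtain t where t: "?\<mu> B / 2 < ?\<mu> (B \<inter> U t)" "f k < t"
      by (auto simp: eventually_sequentially)
    have "?\<mu> (B \<inter> U t) \<le> ?\<mu> (B \<inter> T (t + l) k (f k))"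
      by (intro coin.finite_measure_mono) (auto simp: U_def)
    with t(1) have P: "?P t (f k) k" unfolding P_iff by simp
    \<comment> \<open>Two different values cannot both win: their events are disjoint, and each
      would fill more than half of \<open>B\<close>.\<close>
    have "m' = f k" if "?P t' m' k" for t' m'
    proof (rule ccontr)
      assume ne: "m' \<noteq> f k"
      have "?\<mu> B / 2 < ?\<mu> (B \<inter> S k m')"
        using that TS unfolding P_iff
        by (elim order_less_le_trans) (intro coin.finite_measure_mono; auto)
      moreover have "S k m' \<inter> S k (f k) = {}" using ne by (auto simp: S_def)
      then have "?\<mu> (B \<inter> S k m') + ?\<mu> (B \<inter> S k (f k)) \<le> ?\<mu> B"
        by (subst coin.finite_measure_Union[symmetric]) (auto intro!: coin.finite_measure_mono)
      ultimately show False using gt by simp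
    qed
    with t(2) P show ?thesis by (rule run_d)
  qed
  have "has_density {k. ?\<mu> B / 2 < ?\<mu> (C \<inter> B \<inter> S k (f k))} 1"
    unfolding S_def by (rule density_majority) (use majority in \<open>auto simp: C_def[symmetric]\<close>)
  then have "dense_description (\<lambda>k. run (\<lambda>_. 0) d [k]) f"
    unfolding dense_description_def by (rule has_density_1_mono) (use good in auto)
  then show ?thesis
    using d unfolding densely_computable_def partial_computable_def by auto
qed

section \<open>Null classes\<close>

lemma null_computes_densely:
  assumes "\<not> densely_computable f"
  shows "computes_densely c f \<in> null_sets fair_coin_measure"
proof -
  have "measure coin_flips (computes_densely c f) = 0"
    using densely_computable_if_positive_measure[of c f] assms
    by (metis measure_nonneg order_le_less)
  then have "computes_densely c f \<in> null_sets coin_flips"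
    by (intro null_setsI sets_computes_densely) (simp add: coin.emeasure_eq_measure)
  then show ?thesis unfolding fair_coin_measure_def by (rule null_sets_completionI)
qed

lemma null_densely_computable_in:
  assumes "\<not> densely_computable f"
  shows "{X. densely_computable_in X f} \<in> null_sets fair_coin_measure"
proof -
  have "{X. densely_computable_in X f} = (\<Union>c. computes_densely c f)"
    by (auto simp: densely_computable_in_iff)
  then show ?thesis using null_computes_densely[OF assms] by (simp add: null_sets_UN)
qed

section \<open>Enumeration reducibility to a characteristic function\<close>

text \<open>The pairing dominates its first component, so membership in the graph is decided by a
  bounded search.\<close>

lemma gra_char_fun_iff:
  "j \<in> gra (\<lambda>n. Some (char_fun X n)) \<longleftrightarrow> (\<exists>k<Suc j. prod_encode (k, char_fun X k) = j)"
  unfolding gra_def using le_prod_encode_1 by (auto simp: less_Suc_eq_le)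

text \<open>The graph of a total function is decidable from it, so whatever is enumerated from the
  graph is c.e. in \<open>X\<close>. A partial function with such a graph is computed by searching
  for its value.\<close>

lemma densely_computable_in_if_enum_reducible:
  assumes "dense_description e h" "enum_reducible e (\<lambda>n. Some (char_fun X n))"
  shows "densely_computable_in X h"
proof -
  let ?g = "gra (\<lambda>n. Some (char_fun X n))"
  obtain W where W: "enumeration_operator W" "gra e = enum_apply W ?g"
    using assms(2) unfolding enum_reducible_def by blast
  define V where "V = (\<lambda>(F, k). prod_encode (set_encode F, k)) ` W"
  have "ce_set V" using W(1) unfolding enumeration_operator_def V_def by blast
  then obtain \<phi> w where "V = dom \<phi>" "\<And>n. run (\<lambda>_. 0) w [n] = \<phi> n"
    unfolding ce_set_def partial_computable_def by blast
  then have w: "x \<in> V \<longleftrightarrow> run (\<lambda>_. 0) w [x] \<noteq> None" for x by auto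
  have fin: "finite F" if "(F, k) \<in> W" for F k using W(1) that unfolding enumeration_operator_def by auto
  have V_iff: "prod_encode (u, k) \<in> V \<longleftrightarrow> (set_decode u, k) \<in> W" for u k
  proof
    assume "prod_encode (u, k) \<in> V"
    then obtain F where "(F, k) \<in> W" "u = set_encode F" by (auto simp: V_def)
    then show "(set_decode u, k) \<in> W" using fin by (simp add: set_encode_inverse)
  next
    assume "(set_decode u, k) \<in> W"
    then show "prod_encode (u, k) \<in> V"
      unfolding V_def by (rule rev_image_eqI) simp
  qed
  have W_iff: "e n = Some m \<longleftrightarrow> (\<exists>u. prod_encode (u, prod_encode (n, m)) \<in> V \<and> set_decode u \<subseteq> ?g)" for n m
  proof -
    have "e n = Some m \<longleftrightarrow> prod_encode (n, m) \<in> gra e" by (auto simp: gra_def)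
    also have "\<dots> \<longleftrightarrow> (\<exists>F. (F, prod_encode (n, m)) \<in> W \<and> F \<subseteq> ?g)"
      unfolding W(2) enum_apply_def by simp
    also have "\<dots> \<longleftrightarrow> (\<exists>u. (set_decode u, prod_encode (n, m)) \<in> W \<and> set_decode u \<subseteq> ?g)"
      using fin by (metis set_encode_inverse)
    finally show ?thesis unfolding V_iff .
  qed
  \<comment> \<open>This decides whether the finite set with index \<open>u\<close> lies in the
    graph. Bits at positions \<open>j \<ge> u\<close> vanish because \<open>u < 2 ^ j\<close>, so
    \<open>j < u\<close> covers all elements.\<close>
  let ?Q = "\<lambda>Z u. \<forall>j<u. \<not> odd (u div 2 ^ j) \<or> (\<exists>k<Suc j. prod_encode (k, Z k) = j)"
  \<comment> \<open>The stage \<open>t\<close> bounds both the index \<open>u\<close> and the steps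
    of the enumeration of \<open>W\<close>.\<close>
  let ?P = "\<lambda>Z t m n. \<exists>u<t. 0 < srun (\<lambda>_. 0) t w [prod_encode (u, prod_encode (n, m))] \<and> ?Q Z u"
  have Q_iff: "?Q (char_fun X) u \<longleftrightarrow> set_decode u \<subseteq> ?g" for u
  proof -
    have "j < u" if "odd (u div 2 ^ j)" for j
    proof (rule ccontr)
      assume "\<not> j < u"
      then have "u < 2 ^ j" using less_exp[of j] by linarith
      then show False using that by simp
    qed
    then show ?thesis
      by (simp only: subset_eq set_decode_def mem_Collect_eq gra_char_fun_iff) blast
  qed
  have "ucomp True 2 (\<lambda>Z e. 0)" by (rule ucomp_const)
  then have sr: "ucomp True 3 (\<lambda>Z e. srun (\<lambda>_. 0) (e 0) w [e 2])"
    by (rule ucomp_srun1[where Q = "\<lambda>Z p x. 0"])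
  have sr4: "ucomp True 4 (\<lambda>Z e. srun (\<lambda>_. 0) (e 1) w [prod_encode (e 0, prod_encode (e 3, e 2))])"
    by (rule ucomp_comp3[OF sr, where F = "\<lambda>Z e. e 1" and G = "\<lambda>Z e. e 0" and
          H = "\<lambda>Z e. prod_encode (e 0, prod_encode (e 3, e 2))"])
       (auto intro!: ucomp_var ucomp_prod_encode)
  have "ucomp True 3 (\<lambda>Z e. of_bool (?P Z (e 0) (e 1) (e 2)))"
    apply (rule ucomp_ex)
     apply (rule ucomp_var, simp)
    apply (rule ucomp_conj)
     apply (rule ucomp_less[OF ucomp_const])
     apply (use sr4 in \<open>simp add: eval_nat_numeral\<close>)
    apply (rule ucomp_all)
     apply (rule ucomp_var, simp)
    apply (rule ucomp_disj)
     apply (rule ucomp_not, rule ucomp_odd)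
     apply (intro ucomp_div ucomp_power ucomp_const ucomp_var; simp)
    apply (rule ucomp_ex)
     apply (intro ucomp_Suc ucomp_var; simp)
    apply (intro ucomp_eq ucomp_prod_encode ucomp_query ucomp_var; simp)
    done
  then obtain d where 
    run_d: "\<And>Z n t m. \<lbrakk>m < t; ?P Z t m n; \<And>t' m'. m' < t' \<Longrightarrow> ?P Z t' m' n \<Longrightarrow> m' = m\<rbrakk>
      \<Longrightarrow> run Z d [n] = Some m"
    by (rule ucomp_search) blast
  \<comment> \<open>Soundness, together with single-valuedness of \<open>e\<close>, supplies the
    uniqueness that the search asks for.\<close>
  have sound: "e n = Some m" if "?P (char_fun X) t m n" for t m n
  proof -
    from that obtain u where u: "0 < srun (\<lambda>_. 0) t w [prod_encode (u, prod_encode (n, m))]"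
      "set_decode u \<subseteq> ?g" unfolding Q_iff by blast
    from u(1) have "prod_encode (u, prod_encode (n, m)) \<in> V"
      unfolding w by (metis gr0_implies_Suc option.distinct(1) srun_sound)
    with u(2) show ?thesis unfolding W_iff by blast
  qed
  have "run (char_fun X) d [n] = Some m" if nm: "e n = Some m" for n m
  proof -
    from nm obtain u where u: "prod_encode (u, prod_encode (n, m)) \<in> V" "set_decode u \<subseteq> ?g"
      unfolding W_iff by blast
    from u(1) obtain y where "run (\<lambda>_. 0) w [prod_encode (u, prod_encode (n, m))] = Some y"
      unfolding w by blast
    from eventually_conj[OF srun_complete[OF this] eventually_gt_at_top[of "u + m"]]
    obtain t where t: "srun (\<lambda>_. 0) t w [prod_encode (u, prod_encode (n, m))] = Suc y" "u + m < t"
      by (auto simp: eventually_sequentially)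
    show ?thesis
    proof (rule run_d)
      show "m < t" using t by simp
      show "?P (char_fun X) t m n"
        using t u(2) unfolding Q_iff by (intro exI[of _ u]) simp
      show "m' = m" if "?P (char_fun X) t' m' n" for t' m'
        using sound[OF that] nm by simp
    qed
  qed
  then have "dense_description (\<lambda>n. run (char_fun X) d [n]) h"
    using assms(1) unfolding dense_description_def by (elim has_density_1_mono) auto
  then show ?thesis
    unfolding densely_computable_in_iff computes_densely_def by blast
qed

text \<open>This is the description at which nonuniform reducibility to \<open>X\<close> is
  instantiated.\<close>

lemma dense_description_total: "dense_description (\<lambda>n. Some (g n)) g"
  unfolding dense_description_def has_density_1_iff by simp

lemma ud_reducible_imp_nd_reducible: "h \<le>\<^sub>u\<^sub>d g \<Longrightarrow> h \<le>\<^sub>n\<^sub>d g"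
  unfolding ud_reducible_def nd_reducible_def enum_reducible_def by metis

lemma nd_reducible_imp_densely_computable_in:
  "h \<le>\<^sub>n\<^sub>d char_fun X \<Longrightarrow> densely_computable_in X h"
  using dense_description_total densely_computable_in_if_enum_reducible
  unfolding nd_reducible_def by blast

text \<open>Completeness of the measure enters here: the reducibility classes are shown to be null
  only as subsets of a null class.\<close>

lemma null_sets_fair_coin_measure_subset:
  "A \<in> null_sets fair_coin_measure \<Longrightarrow> B \<subseteq> A \<Longrightarrow> B \<in> null_sets fair_coin_measure"
  unfolding fair_coin_measure_def by (rule null_sets_completion_subset)

theorem theorem6p4:
  "(\<forall>f :: nat \<Rightarrow> nat. \<not> densely_computable f \<longrightarrow>
      {X. densely_computable_in X f} \<in> null_sets fair_coin_measure \<and>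
      (\<forall>X. densely_computable_in X f \<longrightarrow> \<not> weakly_random 4 f X)) \<and>
   (\<forall>A :: nat \<Rightarrow> bool. \<not> densely_computable (char_fun A) \<longrightarrow>
      {X. char_fun A \<le>\<^sub>u\<^sub>d char_fun X} \<in> null_sets fair_coin_measure \<and>
      {X. char_fun A \<le>\<^sub>n\<^sub>d char_fun X} \<in> null_sets fair_coin_measure)"
proof (intro conjI allI impI)
  fix f :: "nat \<Rightarrow> nat" assume f: "\<not> densely_computable f"
  show "{X. densely_computable_in X f} \<in> null_sets fair_coin_measure"
    by (rule null_densely_computable_in[OF f])
  show "\<not> weakly_random 4 f X" if "densely_computable_in X f" for X
    \<comment> \<open>The class of the code that witnesses dense computability from \<open>X\<close>
      is the required null \<Pi>4 class containing \<open>X\<close>.\<close>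
    using that pi_class_computes_densely null_computes_densely[OF f]
    unfolding densely_computable_in_iff weakly_random_def by blast
next
  fix A :: "nat \<Rightarrow> bool" assume "\<not> densely_computable (char_fun A)"
  note null = null_densely_computable_in[OF this]
  show "{X. char_fun A \<le>\<^sub>n\<^sub>d char_fun X} \<in> null_sets fair_coin_measure"
    using null by (rule null_sets_fair_coin_measure_subset)
      (auto intro: nd_reducible_imp_densely_computable_in)
  show "{X. char_fun A \<le>\<^sub>u\<^sub>d char_fun X} \<in> null_sets fair_coin_measure"
    using null by (rule null_sets_fair_coin_measure_subset)
      (auto intro: nd_reducible_imp_densely_computable_in ud_reducible_imp_nd_reducible)
qed

end
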